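(* Let $G=(V,E)$ be a multigraph with $m$ edges (loops counted). Then $$h^\ast(\mathcal C_G;z)=\sum_{H}(2z)^{|H|}(1+z)^{m-|H|},$$ where the sum ranges over all subsets $H\subseteq E$ such that the graph $(V,H)$ is acyclic (contains no cycle; in particular no loop).
   Context: For a finite undirected multigraph $G=(V,E)$ (loops, parallel edges and isolated nodes allowed) with $n=|V|$, $m=|E|$, work in $\mathbb{R}^V\times\mathbb{R}^E\cong\mathbb{R}^{n+m}$ with standard basis vectors $e_u$, $e_f$. For each edge $f$ with endpoints $u,v$ ($u=v$ for a loop) set $\widetilde e_f=e_u+e_v-e_f$, $\overleftarrow e_f=e_u-e_v+e_f$, $\overrightarrow e_f=-e_u+e_v+e_f$. The cosmological polytope $\mathcal C_G$ is the convex hull of $\{e_f,\widetilde e_f,\overleftarrow e_f,\overrightarrow e_f: f\in E\}\cup\{e_u: u\in V\}$, a lattice polytope of dimension $n+m-1$. For a $d$-dimensional lattice polytope $P\subseteq\mathbb{R}^N$, the $h^\ast$-polynomial is defined by $\sum_{j\ge0}|jP\cap\mathbb{Z}^N|z^j=h^\ast(P;z)/(1-z)^{d+1}$. *)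

theory Defs
  imports "HOL-Analysis.Analysis" "HOL-Computational_Algebra.Formal_Power_Series"
begin

text \<open>A finite multigraph is given by a vertex set V, an edge set E, and an endpoint
  map ends: each edge f has endpoints fst (ends f) and snd (ends f) (equal for a loop).
  The orientation of the pair is arbitrary; the generating set of the cosmological
  polytope is invariant under swapping. The ambient space R^V x R^E is modelled as
  real^('v + 'e), coordinates Inl u for vertices and Inr f for edges (coordinates
  outside V and E are identically zero on the polytope).\<close>

definition ev :: "'v \<Rightarrow> real ^ ('v::finite + 'e::finite)" where
  "ev u = axis (Inl u) 1"

definition ee :: "'e \<Rightarrow> real ^ ('v::finite + 'e::finite)" where
  "ee f = axis (Inr f) 1"

definition cosmological_polytope ::
  "'v set \<Rightarrow> 'e set \<Rightarrow> ('e \<Rightarrow> 'v \<times> 'v) \<Rightarrow> (real ^ ('v::finite + 'e::finite)) set" where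
  "cosmological_polytope V E ends = convex hull
     ((\<Union>f\<in>E. let u = fst (ends f); v = snd (ends f) in
        {ee f, ev u + ev v - ee f, ev u - ev v + ee f, - ev u + ev v + ee f})
      \<union> ev ` V)"

definition lattice_count :: "(real ^ 'n::finite) set \<Rightarrow> nat \<Rightarrow> nat" where
  "lattice_count P j = card {x \<in> (\<lambda>y. real j *\<^sub>R y) ` P. \<forall>i. x $ i \<in> \<int>}"

definition ehrhart_series :: "(real ^ 'n::finite) set \<Rightarrow> int fps" where
  "ehrhart_series P = Abs_fps (\<lambda>j. int (lattice_count P j))"

text \<open>The h*-series: Ehrhart series times (1-z)^(d+1), d = dim P (affine dimension).
  By definition h*(P;z) is the polynomial with this power series.\<close>
definition h_star_series :: "(real ^ 'n::finite) set \<Rightarrow> int fps" where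
  "h_star_series P = ehrhart_series P * (1 - fps_X) ^ nat (aff_dim P + 1)"

text \<open>A cycle in the multigraph (V,H): distinct edges e_0..e_(k-1) (k \<ge> 1) and distinct
  vertices v_0..v_(k-1) such that e_i joins v_i and v_(i+1 mod k). k = 1 gives a loop,
  k = 2 a pair of parallel edges.\<close>
definition has_cycle :: "('e \<Rightarrow> 'v \<times> 'v) \<Rightarrow> 'e set \<Rightarrow> bool" where
  "has_cycle ends H \<longleftrightarrow> (\<exists>es vs. length es = length vs \<and> length es \<ge> 1 \<and>
     distinct es \<and> distinct vs \<and> set es \<subseteq> H \<and>
     (\<forall>i < length es. {fst (ends (es ! i)), snd (ends (es ! i))}
                       = {vs ! i, vs ! ((i + 1) mod length es)}))"

end

theory Submission
  imports Defs
begin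

text \<open>
  For a fixed edge vector y, the slice of the cone over the polytope is, up to a translation that
  absorbs the negative entries of y, the polyhedron of all x with
  x(S) + c(\<delta> S) \<ge> 0 for all vertex sets S, where c is the positive part of y.
  Since cut functions are submodular, its lattice points on every line in
  direction u - v form a nonempty interval; raising the capacity of the edge uv from 0 to c
  lengthens each such interval by 2c, and the lines correspond to the lattice points after
  contracting u and v. This deletion-contraction recursion gives the generating function
  by level as the sum over forests H of \<Prod>f\<in>H. 2 c f (1 - z), divided by (1 - z)^|V|.
  Summing over all y turns each edge of H into 2z and each other edge into 1 + z.
\<close>

section \<open>Acyclicity and contraction\<close>

text \<open>The inequalities and the generators are compared at lattice points only. The generators
  satisfy the inequalities; conversely, a lattice point satisfying them is written as a conic
  combination by removing one edge at a time. Its multipliers may be half-integers, which is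
  harmless because only membership in the real cone is at stake. All generators have coordinate sum
  1, so the j-th dilate is the part of the cone with coordinate sum j. An edge vector y uses up the
  sum of all |y f| of this level, which is the origin of the factors z^|y f|. Submodularity keeps
  every fibre nonempty. Otherwise the size of a fibre would be a truncated, not a linear, function
  of its two ends, and the recursion would break. Contraction changes vertices and endpoint map but
  keeps the names of the edges, so the forests on both sides of the recursion are subsets of the
  same edge set. The coefficient of z^N involves only dilates up to N, hence only y with entries in
  [-N, N]. The sum over all y thus becomes a finite sum, and limits become congruences modulo
  z^(N+1).\<close>

definition adjacency :: "('e \<Rightarrow> 'v \<times> 'v) \<Rightarrow> 'e set \<Rightarrow> ('v \<times> 'v) set" where
  "adjacency ends H = {(a, b). \<exists>e\<in>H. {fst (ends e), snd (ends e)} = {a, b}}"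

abbreviation connected_by :: "('e \<Rightarrow> 'v \<times> 'v) \<Rightarrow> 'e set \<Rightarrow> ('v \<times> 'v) set" where
  "connected_by ends H \<equiv> (adjacency ends H)\<^sup>*"

lemma connected_by_sym: "(a, b) \<in> connected_by ends H \<Longrightarrow> (b, a) \<in> connected_by ends H"
proof -
  have "sym (adjacency ends H)"
    by (auto simp: sym_def adjacency_def insert_commute)
  then show "(a, b) \<in> connected_by ends H \<Longrightarrow> (b, a) \<in> connected_by ends H"
    by (meson symD sym_rtrancl)
qed

lemma adjacencyI: "e \<in> H \<Longrightarrow> (fst (ends e), snd (ends e)) \<in> adjacency ends H"
  unfolding adjacency_def by blast

text \<open>A cycle needs distinct vertices and edges, while reachability only gives a walk. When a
  step returns to a vertex of the path, the path is cut back to it; otherwise the step is appended,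
  and its edge is new because all earlier edges have both endpoints on the path.\<close>

lemma simple_path_exists:
  assumes "(a, b) \<in> connected_by ends H"
  shows "\<exists>es vs. length vs = Suc (length es) \<and> vs ! 0 = a \<and> vs ! length es = b \<and>
     distinct vs \<and> distinct es \<and> set es \<subseteq> H \<and>
     (\<forall>i < length es. {fst (ends (es ! i)), snd (ends (es ! i))} = {vs ! i, vs ! Suc i})"
  using assms
proof (induction rule: rtrancl_induct)
  case base
  show ?case
    by (rule exI[of _ "[]"], rule exI[of _ "[a]"]) auto
next
  case (step y z)
  then obtain es vs where p: "length vs = Suc (length es)" "vs ! 0 = a" "vs ! length es = y"
    "distinct vs" "distinct es" "set es \<subseteq> H"
    "\<forall>i < length es. {fst (ends (es ! i)), snd (ends (es ! i))} = {vs ! i, vs ! Suc i}"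
    by blast
  obtain h where h: "h \<in> H" "{fst (ends h), snd (ends h)} = {y, z}"
    using step.hyps by (auto simp: adjacency_def)
  show ?case
  proof (cases "z \<in> set vs")
    case True
    then obtain k where k: "k < length vs" "vs ! k = z"
      by (auto simp: in_set_conv_nth)
    have "set (take k es) \<subseteq> H" "distinct (take k es)" "distinct (take (Suc k) vs)"
      using p(4-6) set_take_subset by fastforce+
    moreover have "length (take (Suc k) vs) = Suc (length (take k es))"
      "take (Suc k) vs ! 0 = a" "take (Suc k) vs ! length (take k es) = z"
      using p(1,2) k by simp_all
    moreover have "\<forall>i < length (take k es). {fst (ends (take k es ! i)), snd (ends (take k es ! i))}
        = {take (Suc k) vs ! i, take (Suc k) vs ! Suc i}"
      using p(7) by simp
    ultimately show ?thesis
      by blast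
  next
    case False
    have "h \<notin> set es"
    proof
      assume "h \<in> set es"
      then obtain i where i: "i < length es" "es ! i = h"
        by (auto simp: in_set_conv_nth)
      then have "z \<in> {vs ! i, vs ! Suc i}"
        using p(7) h(2) by blast
      then show False
        using False i p(1) nth_mem[of i vs] nth_mem[of "Suc i" vs] by auto
    qed
    then show ?thesis
      using False p h
      by (intro exI[of _ "es @ [h]"] exI[of _ "vs @ [z]"]) (auto simp: nth_append less_Suc_eq)
  qed
qed

lemma has_cycle_mono: "has_cycle ends H \<Longrightarrow> H \<subseteq> K \<Longrightarrow> has_cycle ends K"
  unfolding has_cycle_def by (meson subset_trans)

lemma not_has_cycle_empty: "\<not> has_cycle ends {}"
  by (auto simp: has_cycle_def)

text \<open>Closes a simple path between the endpoints of \<open>g\<close> by \<open>g\<close>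
  itself. The empty path covers a loop, a path of length one covers a parallel edge.\<close>

lemma has_cycle_insertI:
  assumes "(fst (ends g), snd (ends g)) \<in> connected_by ends H" "g \<notin> H"
  shows "has_cycle ends (insert g H)"
proof -
  obtain es vs where p: "length vs = Suc (length es)" "vs ! 0 = fst (ends g)"
    "vs ! length es = snd (ends g)" "distinct vs" "distinct es" "set es \<subseteq> H"
    "\<forall>i < length es. {fst (ends (es ! i)), snd (ends (es ! i))} = {vs ! i, vs ! Suc i}"
    using simple_path_exists[OF assms(1)] by blast
  have "{fst (ends ((es @ [g]) ! i)), snd (ends ((es @ [g]) ! i))}
      = {vs ! i, vs ! ((i + 1) mod length (es @ [g]))}" if "i < length (es @ [g])" for i
    using that p by (cases "i = length es") (auto simp: nth_append)
  moreover have "distinct (es @ [g])" "set (es @ [g]) \<subseteq> insert g H"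
    using p assms(2) by auto
  moreover have "length (es @ [g]) = length vs" "length (es @ [g]) \<ge> 1"
    using p(1) by simp_all
  ultimately show ?thesis
    unfolding has_cycle_def using p(4) by blast
qed

lemma has_cycle_insertD:
  assumes "has_cycle ends (insert g H)" "\<not> has_cycle ends H"
  shows "(fst (ends g), snd (ends g)) \<in> connected_by ends H"
proof -
  obtain es vs where p: "length es = length vs" "length es \<ge> 1" "distinct es" "distinct vs"
    "set es \<subseteq> insert g H"
    "\<forall>i < length es. {fst (ends (es ! i)), snd (ends (es ! i))}
       = {vs ! i, vs ! ((i + 1) mod length es)}"
    using assms(1) unfolding has_cycle_def by blast
  have "g \<in> set es"
  proof (rule ccontr)
    assume "g \<notin> set es"
    then have "set es \<subseteq> H"
      using p(5) by blast
    then show False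
      using p assms(2) unfolding has_cycle_def by blast
  qed
  then obtain i where i: "i < length es" "es ! i = g"
    by (auto simp: in_set_conv_nth)
  let ?k = "length es"
  \<comment> \<open>Walk round the cycle starting behind \<open>g\<close>, which sits at position i.
    The bound \<open>d < ?k\<close> keeps the walk from using position i, so only edges of
    \<open>H\<close> occur; \<open>d = ?k - 1\<close> arrives at the other endpoint of
    \<open>g\<close>.\<close>
  have path: "(vs ! ((i + 1) mod ?k), vs ! ((i + 1 + d) mod ?k)) \<in> connected_by ends H"
    if "d < ?k" for d
    using that
  proof (induction d)
    case (Suc d)
    let ?l = "(i + 1 + d) mod ?k"
    have l: "?l < ?k"
      using p(2) by (intro mod_less_divisor) linarith
    have "?l \<noteq> i"
    proof (cases "i + 1 + d < ?k")
      case False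
      then have "?l = i + 1 + d - ?k"
        using i Suc.prems by (simp add: mod_if)
      then show ?thesis
        using False i Suc.prems by linarith
    qed simp
    then have "es ! ?l \<in> H"
      using p(3,5) i l by (metis insert_iff nth_eq_iff_index_eq nth_mem subset_iff)
    moreover have "{fst (ends (es ! ?l)), snd (ends (es ! ?l))}
        = {vs ! ?l, vs ! ((i + 1 + Suc d) mod ?k)}"
      using p(6) l by (simp add: mod_Suc_eq)
    ultimately have "(vs ! ?l, vs ! ((i + 1 + Suc d) mod ?k)) \<in> adjacency ends H"
      by (auto simp: adjacency_def)
    with Suc show ?case
      by (simp add: rtrancl.rtrancl_into_rtrancl)
  qed simp
  have "(i + 1 + (?k - 1)) mod ?k = i"
  proof -
    have "i + 1 + (?k - 1) = i + ?k"
      using p(2) by linarith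
    then show ?thesis
      using i by simp
  qed
  then have "(vs ! ((i + 1) mod ?k), vs ! i) \<in> connected_by ends H"
    using path[of "?k - 1"] p(2) i by auto
  moreover have "{fst (ends g), snd (ends g)} = {vs ! i, vs ! ((i + 1) mod ?k)}"
    using p(6) i by auto
  ultimately show ?thesis
    by (metis connected_by_sym doubleton_eq_iff)
qed

lemma has_cycle_insert_iff:
  assumes "g \<notin> H"
  shows "has_cycle ends (insert g H) \<longleftrightarrow>
    has_cycle ends H \<or> (fst (ends g), snd (ends g)) \<in> connected_by ends H"
proof
  show "has_cycle ends (insert g H) \<Longrightarrow>
      has_cycle ends H \<or> (fst (ends g), snd (ends g)) \<in> connected_by ends H"
    using has_cycle_insertD by fast
qed (use has_cycle_insertI[OF _ assms] has_cycle_mono[of ends H "insert g H"] in auto)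

section \<open>Contraction of an edge\<close>

definition contract :: "'v \<Rightarrow> 'v \<Rightarrow> 'v \<Rightarrow> 'v" where
  "contract u v = id(v := u)"

definition contract_ends :: "'v \<Rightarrow> 'v \<Rightarrow> ('e \<Rightarrow> 'v \<times> 'v) \<Rightarrow> 'e \<Rightarrow> 'v \<times> 'v" where
  "contract_ends u v ends f = map_prod (contract u v) (contract u v) (ends f)"

lemma contract_ends_simps [simp]:
  "fst (contract_ends u v ends f) = contract u v (fst (ends f))"
  "snd (contract_ends u v ends f) = contract u v (snd (ends f))"
  by (simp_all add: contract_ends_def)

text \<open>Since \<open>f\<close> joins u and v, each vertex is connected to its image under the
  contraction; a step along \<open>f\<close> becomes stationary, every other step keeps its
  edge.\<close>

lemma connected_by_contract:
  assumes "ends f = (u, v)"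
  shows "(a, b) \<in> connected_by ends (insert f H) \<longleftrightarrow>
    (contract u v a, contract u v b) \<in> connected_by (contract_ends u v ends) H"
proof
  let ?c = "contract u v" and ?K = "connected_by ends (insert f H)"
  assume "(a, b) \<in> ?K"
  then show "(?c a, ?c b) \<in> connected_by (contract_ends u v ends) H"
  proof (induction rule: rtrancl_induct)
    case (step y z)
    then obtain e where e: "e \<in> insert f H" "{fst (ends e), snd (ends e)} = {y, z}"
      by (auto simp: adjacency_def)
    have "?c y = ?c z \<or> (?c y, ?c z) \<in> adjacency (contract_ends u v ends) H"
    proof (cases "e = f")
      case True
      then show ?thesis
        using e assms by (auto simp: contract_def doubleton_eq_iff)
    next
      case False
      then have "e \<in> H"
        using e by simp
      then show ?thesis
        using e by (force simp: adjacency_def doubleton_eq_iff)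
    qed
    with step.IH show ?case
      by (metis rtrancl.rtrancl_into_rtrancl)
  qed simp
next
  let ?c = "contract u v" and ?K = "connected_by ends (insert f H)"
  have c: "(x, ?c x) \<in> ?K" for x
  proof (cases "x = v")
    case True
    have "(u, v) \<in> ?K"
      using adjacencyI[of f "insert f H" ends] assms by auto
    then show ?thesis
      using True by (simp add: contract_def connected_by_sym)
  qed (simp add: contract_def)
  have "(p, q) \<in> connected_by (contract_ends u v ends) H \<Longrightarrow> (p, q) \<in> ?K" for p q
  proof (induction rule: rtrancl_induct)
    case (step y z)
    then obtain e where e: "e \<in> H" "{?c (fst (ends e)), ?c (snd (ends e))} = {y, z}"
      by (auto simp: adjacency_def)
    have "(fst (ends e), snd (ends e)) \<in> ?K"
      using e adjacencyI[of e "insert f H"] by auto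
    then have "(?c (fst (ends e)), ?c (snd (ends e))) \<in> ?K"
      by (meson c connected_by_sym rtrancl_trans)
    then have "(y, z) \<in> ?K"
      using e connected_by_sym by (metis doubleton_eq_iff)
    with step.IH show ?case
      by (rule rtrancl_trans)
  qed simp
  moreover assume "(?c a, ?c b) \<in> connected_by (contract_ends u v ends) H"
  ultimately show "(a, b) \<in> ?K"
    by (meson c connected_by_sym rtrancl_trans)
qed

text \<open>No cycle is transported explicitly. The edges of \<open>H\<close> are inserted one by
  one: by \<open>has_cycle_insert_iff\<close> each insertion only asks whether two vertices are
  already connected, and \<open>connected_by_contract\<close> answers this alike on both
  sides.\<close>

lemma has_cycle_contract:
  assumes "ends f = (u, v)" "u \<noteq> v" "finite H" "f \<notin> H"
  shows "has_cycle ends (insert f H) \<longleftrightarrow> has_cycle (contract_ends u v ends) H"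
  using assms(3,4)
proof (induction H rule: finite_induct)
  case empty
  then show ?case
    using has_cycle_insert_iff[of f "{}" ends] assms(1,2)
    by (simp add: not_has_cycle_empty adjacency_def)
next
  case (insert g H)
  have "has_cycle ends (insert f (insert g H)) \<longleftrightarrow> has_cycle ends (insert f H) \<or>
      (fst (ends g), snd (ends g)) \<in> connected_by ends (insert f H)"
    using has_cycle_insert_iff[of g "insert f H" ends] insert by (auto simp: insert_commute)
  also have "\<dots> \<longleftrightarrow> has_cycle (contract_ends u v ends) (insert g H)"
    using insert has_cycle_insert_iff[of g H "contract_ends u v ends"]
      connected_by_contract[of ends f u v "fst (ends g)" "snd (ends g)" H] assms(1) by simp
  finally show ?case .
qed

section \<open>Lattice points under submodular constraints\<close>

text \<open>For submodular \<open>h\<close> these are the lattice points at level t of the extended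
  contrapolymatroid of -h. Values outside V are fixed to 0 so that each point is one function and
  sets of points can be counted.\<close>

definition lower_points :: "'v set \<Rightarrow> ('v set \<Rightarrow> int) \<Rightarrow> int \<Rightarrow> ('v \<Rightarrow> int) set" where
  "lower_points V h t =
    {x. (\<forall>v. v \<notin> V \<longrightarrow> x v = 0) \<and> sum x V = t \<and> (\<forall>S\<subseteq>V. 0 \<le> sum x S + h S)}"

definition submodular :: "('v set \<Rightarrow> int) \<Rightarrow> bool" where
  "submodular h \<longleftrightarrow> (\<forall>S T. h (S \<union> T) + h (S \<inter> T) \<le> h S + h T)"

text \<open>The constraint at {v} bounds x v from below; the constraint at V - {v} together with the
  fixed total bounds it from above.\<close>

lemma finite_lower_points:
  assumes "finite V"
  shows "finite (lower_points V h t)"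
proof -
  define B where "B = \<bar>t\<bar> + (\<Sum>S\<in>Pow V. \<bar>h S\<bar>)"
  have h: "\<bar>h S\<bar> \<le> B - \<bar>t\<bar>" if "S \<subseteq> V" for S
    unfolding B_def using member_le_sum[of S "Pow V" "\<lambda>S. \<bar>h S\<bar>"] that assms by simp
  have "x v \<in> {-B..B}" if "x \<in> lower_points V h t" "v \<in> V" for x v
  proof -
    have "0 \<le> sum x {v} + h {v}" "0 \<le> sum x (V - {v}) + h (V - {v})" "sum x V = t"
      using that by (auto simp: lower_points_def simp del: sum.insert)
    moreover have "sum x V = x v + sum x (V - {v})"
      using that assms by (simp add: sum.remove)
    ultimately show ?thesis
      using h[of "{v}"] h[of "V - {v}"] that(2) by auto
  qed
  then have "lower_points V h t \<subseteq>
      {x. \<forall>v. (v \<in> V \<longrightarrow> x v \<in> {-B..B}) \<and> (v \<notin> V \<longrightarrow> x v = 0)}"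
    by (auto simp: lower_points_def)
  then show ?thesis
    using finite_set_of_finite_funs[OF assms, of "{-B..B}" 0] finite_subset by blast
qed

section \<open>Fibres of merging two coordinates\<close>

definition merge_coords :: "'v \<Rightarrow> 'v \<Rightarrow> ('v \<Rightarrow> int) \<Rightarrow> 'v \<Rightarrow> int" where
  "merge_coords u v x = x(u := x u + x v, v := 0)"

definition contract_fun :: "'v set \<Rightarrow> 'v \<Rightarrow> 'v \<Rightarrow> ('v set \<Rightarrow> int) \<Rightarrow> 'v set \<Rightarrow> int" where
  "contract_fun V u v h S = h (contract u v -` S \<inter> V)"

text \<open>The least value of the coordinate u (swapping u and v: of the coordinate v) on the
  line of points that merge to q.\<close>

definition fibre_bound :: "'v set \<Rightarrow> 'v \<Rightarrow> 'v \<Rightarrow> ('v set \<Rightarrow> int) \<Rightarrow> ('v \<Rightarrow> int) \<Rightarrow> int" where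
  "fibre_bound V u v h q = Max ((\<lambda>R. - h (insert u R) - sum q R) ` Pow (V - {u, v}))"

lemma fibre_bound_le_iff:
  assumes "finite V"
  shows "fibre_bound V u v h q \<le> a \<longleftrightarrow> (\<forall>R\<subseteq>V - {u, v}. 0 \<le> a + sum q R + h (insert u R))"
proof -
  have "fibre_bound V u v h q \<le> a \<longleftrightarrow> (\<forall>R\<subseteq>V - {u, v}. - h (insert u R) - sum q R \<le> a)"
    unfolding fibre_bound_def using assms by (subst Max_le_iff) auto
  moreover have "- h (insert u R) - sum q R \<le> a \<longleftrightarrow> 0 \<le> a + sum q R + h (insert u R)" for R
    by linarith
  ultimately show ?thesis
    by simp
qed

lemma fibre_bound_attained:
  assumes "finite V"
  obtains R where "R \<subseteq> V - {u, v}" "fibre_bound V u v h q = - h (insert u R) - sum q R"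
proof -
  have "fibre_bound V u v h q \<in> (\<lambda>R. - h (insert u R) - sum q R) ` Pow (V - {u, v})"
    unfolding fibre_bound_def using assms by (intro Max_in) auto
  then show ?thesis
    using that by blast
qed

definition add_separator :: "'v \<Rightarrow> 'v \<Rightarrow> int \<Rightarrow> ('v set \<Rightarrow> int) \<Rightarrow> 'v set \<Rightarrow> int" where
  "add_separator u v k h S = h S + (if u \<in> S \<longleftrightarrow> v \<in> S then 0 else k)"

lemma submodular_add_separator:
  assumes "submodular h" "0 \<le> k"
  shows "submodular (add_separator u v k h)"
  unfolding submodular_def
proof (intro allI)
  fix S T
  have "h (S \<union> T) + h (S \<inter> T) \<le> h S + h T"
    using assms(1) unfolding submodular_def by blast
  then show "add_separator u v k h (S \<union> T) + add_separator u v k h (S \<inter> T)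
      \<le> add_separator u v k h S + add_separator u v k h T"
    using assms(2) unfolding add_separator_def
    by (cases "u \<in> S"; cases "v \<in> S"; cases "u \<in> T"; cases "v \<in> T") simp_all
qed

context
  fixes V :: "'v set" and u v :: 'v
  assumes fin: "finite V" and u: "u \<in> V" and v: "v \<in> V" and uv: "u \<noteq> v"
begin

lemma contract_vimage_insert:
  "R \<subseteq> V - {u, v} \<Longrightarrow> contract u v -` insert u R \<inter> V = insert u (insert v R)"
  using u v uv by (auto simp: contract_def split: if_splits)

lemma contract_vimage: "R \<subseteq> V - {u, v} \<Longrightarrow> contract u v -` R \<inter> V = R"
  using u v uv by (auto simp: contract_def split: if_splits)

lemma all_subsets_split:
  "(\<forall>S\<subseteq>V. P S) \<longleftrightarrow> (\<forall>R\<subseteq>V - {u, v}. P R \<and> P (insert u R) \<and> P (insert v R) \<and>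
     P (insert u (insert v R)))" (is "?l \<longleftrightarrow> ?r")
proof
  assume l: ?l
  show ?r
  proof (intro allI impI)
    fix R assume "R \<subseteq> V - {u, v}"
    then have "R \<subseteq> V" "insert u R \<subseteq> V" "insert v R \<subseteq> V" "insert u (insert v R) \<subseteq> V"
      using u v by auto
    with l show "P R \<and> P (insert u R) \<and> P (insert v R) \<and> P (insert u (insert v R))"
      by blast
  qed
next
  assume r: ?r
  show ?l
  proof (intro allI impI)
    fix S assume S: "S \<subseteq> V"
    let ?R = "S - {u, v}"
    have "P ?R \<and> P (insert u ?R) \<and> P (insert v ?R) \<and> P (insert u (insert v ?R))"
      by (rule r[rule_format]) (use S in blast)
    moreover have "S = ?R \<or> S = insert u ?R \<or> S = insert v ?R \<or> S = insert u (insert v ?R)"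
      by blast
    ultimately show "P S"
      by (elim disjE) simp_all
  qed
qed

lemma all_contracted_subsets_split:
  "(\<forall>S\<subseteq>V - {v}. P S) \<longleftrightarrow> (\<forall>R\<subseteq>V - {u, v}. P R \<and> P (insert u R))" (is "?l \<longleftrightarrow> ?r")
proof
  assume l: ?l
  show ?r
  proof (intro allI impI)
    fix R assume "R \<subseteq> V - {u, v}"
    then have "R \<subseteq> V - {v}" "insert u R \<subseteq> V - {v}"
      using u uv by auto
    with l show "P R \<and> P (insert u R)"
      by blast
  qed
next
  assume r: ?r
  show ?l
  proof (intro allI impI)
    fix S assume S: "S \<subseteq> V - {v}"
    let ?R = "S - {u, v}"
    have "P ?R \<and> P (insert u ?R)"
      by (rule r[rule_format]) (use S in blast)
    moreover have "S = ?R \<or> S = insert u ?R"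
      using S by blast
    ultimately show "P S"
      by (elim disjE) simp_all
  qed
qed

lemma sum_split:
  fixes x :: "'v \<Rightarrow> int"
  assumes "R \<subseteq> V - {u, v}"
  shows "sum x (insert u R) = x u + sum x R" "sum x (insert v R) = x v + sum x R"
    "sum x (insert u (insert v R)) = x u + x v + sum x R"
proof -
  have "finite R" "u \<notin> R" "v \<notin> R"
    using assms fin finite_subset by auto
  then show "sum x (insert u R) = x u + sum x R" "sum x (insert v R) = x v + sum x R"
    "sum x (insert u (insert v R)) = x u + x v + sum x R"
    using uv by simp_all
qed

lemma sum_merge:
  assumes "R \<subseteq> V - {u, v}"
  shows "sum (merge_coords u v x) R = sum x R"
  using assms by (intro sum.cong) (auto simp: merge_coords_def)

lemma sum_merge_insert:
  assumes "R \<subseteq> V - {u, v}"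
  shows "sum (merge_coords u v x) (insert u R) = x u + x v + sum x R"
proof -
  have "merge_coords u v x u = x u + x v"
    using uv by (simp add: merge_coords_def)
  then show ?thesis
    using sum_split(1)[OF assms, of "merge_coords u v x"] sum_merge[OF assms, of x] by simp
qed

text \<open>Sets containing both or neither of u and v see only x u + x v and give the contracted
  system. Sets containing just u bound x u from below, sets containing just v bound x v. With the
  sum x u + x v fixed, the fibre is therefore an interval.\<close>

lemma mem_lower_points_iff:
  assumes "\<forall>w. w \<notin> V \<longrightarrow> x w = 0"
  shows "x \<in> lower_points V h t \<longleftrightarrow>
    merge_coords u v x \<in> lower_points (V - {v}) (contract_fun V u v h) t \<and>
    fibre_bound V u v h (merge_coords u v x) \<le> x u \<and> fibre_bound V v u h (merge_coords u v x) \<le> x v"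
    (is "_ \<longleftrightarrow> ?m \<and> ?U \<and> ?V")
proof -
  have V: "V - {v} = insert u (V - {u, v})" "V = insert u (insert v (V - {u, v}))"
    using u v uv by auto
  have U: "?U \<longleftrightarrow> (\<forall>R\<subseteq>V - {u, v}. 0 \<le> sum x (insert u R) + h (insert u R))"
    unfolding fibre_bound_le_iff[OF fin] by (auto simp: sum_merge sum_split)
  have W: "?V \<longleftrightarrow> (\<forall>R\<subseteq>V - {u, v}. 0 \<le> sum x (insert v R) + h (insert v R))"
    unfolding fibre_bound_le_iff[OF fin]
      insert_commute[of v u "{}"] by (auto simp: sum_merge sum_split)
  have s: "sum (merge_coords u v x) (V - {v}) = sum x V"
  proof -
    have "sum (merge_coords u v x) (V - {v}) = x u + x v + sum x (V - {u, v})"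
      by (subst V) (simp add: sum_merge_insert)
    also have "\<dots> = sum x V"
      by (subst (2) V(2)) (use sum_split(3)[of "V - {u, v}" x] in simp)
    finally show ?thesis .
  qed
  have "?m \<longleftrightarrow> sum x V = t \<and> (\<forall>R\<subseteq>V - {u, v}. 0 \<le> sum x R + h R \<and>
      0 \<le> sum x (insert u (insert v R)) + h (insert u (insert v R)))"
  proof -
    have "\<forall>w. w \<notin> V - {v} \<longrightarrow> merge_coords u v x w = 0"
      using assms u by (simp add: merge_coords_def)
    moreover have "(\<forall>S\<subseteq>V - {v}. 0 \<le> sum (merge_coords u v x) S + contract_fun V u v h S) \<longleftrightarrow>
        (\<forall>R\<subseteq>V - {u, v}. 0 \<le> sum x R + h R \<and>
          0 \<le> sum x (insert u (insert v R)) + h (insert u (insert v R)))"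
      unfolding all_contracted_subsets_split
      by (simp add: contract_fun_def contract_vimage contract_vimage_insert
          sum_merge sum_merge_insert sum_split(3) del: sum.insert cong: imp_cong)
    ultimately show ?thesis
      unfolding lower_points_def mem_Collect_eq s by simp
  qed
  moreover have "x \<in> lower_points V h t \<longleftrightarrow> sum x V = t \<and>
      (\<forall>R\<subseteq>V - {u, v}. 0 \<le> sum x R + h R \<and> 0 \<le> sum x (insert u R) + h (insert u R) \<and>
        0 \<le> sum x (insert v R) + h (insert v R) \<and>
        0 \<le> sum x (insert u (insert v R)) + h (insert u (insert v R)))"
    unfolding lower_points_def mem_Collect_eq all_subsets_split using assms by simp
  ultimately show ?thesis
    unfolding U W by metis
qed

text \<open>Uncrossing: let \<open>insert u R\<close> and \<open>insert v T\<close> attain the two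
  bounds. Their union contains both u and v, their intersection neither, so submodularity reduces
  the claim to two constraints of the contracted system.\<close>

lemma fibre_nonempty:
  assumes "submodular h" "q \<in> lower_points (V - {v}) (contract_fun V u v h) t"
  shows "fibre_bound V u v h q + fibre_bound V v u h q \<le> q u"
proof -
  obtain R where R: "R \<subseteq> V - {u, v}" "fibre_bound V u v h q = - h (insert u R) - sum q R"
    by (rule fibre_bound_attained[OF fin])
  obtain T where T: "T \<subseteq> V - {u, v}" "fibre_bound V v u h q = - h (insert v T) - sum q T"
    using fibre_bound_attained[OF fin, of v u h q] insert_commute[of v u "{}"] by metis
  have ne: "u \<notin> R" "v \<notin> R" "u \<notin> T" "v \<notin> T" 
    using R T by auto
  have f: "finite R" "finite T"
    by (rule finite_subset[OF _ fin], use R T in blast)+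
  have sub: "h (insert u R \<union> insert v T) + h (insert u R \<inter> insert v T) \<le> h (insert u R) + h (insert v T)"
    using assms(1) unfolding submodular_def by blast
  have eq: "insert u R \<union> insert v T = insert u (insert v (R \<union> T))"
    "insert u R \<inter> insert v T = R \<inter> T"
    using ne uv by auto
  note sub[unfolded eq]
  moreover have "sum q (R \<union> T) + sum q (R \<inter> T) = sum q R + sum q T"
    using f by (rule sum.union_inter)
  moreover have RT: "R \<union> T \<subseteq> V - {u, v}" "R \<inter> T \<subseteq> V - {u, v}"
    using R T by auto
  have *: "\<forall>S\<subseteq>V - {v}. 0 \<le> sum q S + contract_fun V u v h S"
    using assms(2) by (simp add: lower_points_def)
  have "0 \<le> sum q (insert u (R \<union> T)) + contract_fun V u v h (insert u (R \<union> T))"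
    "0 \<le> sum q (R \<inter> T) + contract_fun V u v h (R \<inter> T)"
    by (rule *[rule_format], use RT u uv in blast)+
  then have "0 \<le> q u + sum q (R \<union> T) + h (insert u (insert v (R \<union> T)))"
    "0 \<le> sum q (R \<inter> T) + h (R \<inter> T)"
    using RT by (simp_all only: contract_fun_def contract_vimage contract_vimage_insert sum_split)
  ultimately show ?thesis
    using R T by linarith
qed

text \<open>By \<open>fibre_nonempty\<close> the integer expression in the sum is the true size of
  each interval, with no truncation at 0. Hence the count is linear in the two bounds.\<close>

lemma card_lower_points:
  assumes "submodular h"
  shows "int (card (lower_points V h t)) =
    (\<Sum>q\<in>lower_points (V - {v}) (contract_fun V u v h) t.
       q u - fibre_bound V v u h q - fibre_bound V u v h q + 1)"
proof -
  let ?Q = "lower_points (V - {v}) (contract_fun V u v h) t"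
  let ?F = "\<lambda>q. {fibre_bound V u v h q .. q u - fibre_bound V v u h q}"
  have "bij_betw (\<lambda>x. (merge_coords u v x, x u)) (lower_points V h t) (SIGMA q:?Q. ?F q)"
  \<comment> \<open>A point is recovered from its merged image and its coordinate at u, because v
    carries the rest of the merged value.\<close>
  proof (rule bij_betwI[where g = "\<lambda>(q, a). q(u := a, v := q u - a)"])
    show "(\<lambda>x. (merge_coords u v x, x u)) \<in> lower_points V h t \<rightarrow> (SIGMA q:?Q. ?F q)"
    proof
      fix x assume x: "x \<in> lower_points V h t"
      then have "\<forall>w. w \<notin> V \<longrightarrow> x w = 0"
        by (simp add: lower_points_def)
      from mem_lower_points_iff[OF this] x uv
      show "(merge_coords u v x, x u) \<in> (SIGMA q:?Q. ?F q)"
        by (auto simp: merge_coords_def)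
    qed
    show "(\<lambda>(q, a). q(u := a, v := q u - a)) \<in> (SIGMA q:?Q. ?F q) \<rightarrow> lower_points V h t"
    proof clarify
      fix q a assume q: "q \<in> ?Q" and a: "a \<in> ?F q"
      define x where "x = q(u := a, v := q u - a)"
      have "q v = 0" and z: "\<forall>w. w \<notin> V \<longrightarrow> x w = 0"
        using q u v by (auto simp: x_def lower_points_def)
      then have "merge_coords u v x = q"
        using uv by (auto simp: x_def merge_coords_def fun_eq_iff)
      moreover have "x u = a" "x v = q u - a"
        using uv by (simp_all add: x_def)
      ultimately have "x \<in> lower_points V h t"
        using mem_lower_points_iff[OF z] q a by auto
      then show "q(u := a, v := q u - a) \<in> lower_points V h t"
        by (simp only: x_def)
    qed
  next
    fix x
    show "(case (merge_coords u v x, x u) of (q, a) \<Rightarrow> q(u := a, v := q u - a)) = x"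
      using uv by (auto simp: merge_coords_def fun_eq_iff)
  next
    fix y assume y: "y \<in> (SIGMA q:?Q. ?F q)"
    then have "fst y v = 0"
      by (auto simp: lower_points_def)
    then show "(merge_coords u v (case y of (q, a) \<Rightarrow> q(u := a, v := q u - a)),
        (case y of (q, a) \<Rightarrow> q(u := a, v := q u - a)) u) = y"
      using uv by (auto simp: merge_coords_def fun_eq_iff split: prod.splits)
  qed
  then have "card (lower_points V h t) = card (SIGMA q:?Q. ?F q)"
    by (rule bij_betw_same_card)
  also have "\<dots> = (\<Sum>q\<in>?Q. card (?F q))"
    using fin by (intro card_SigmaI) (auto intro: finite_lower_points)
  finally have "int (card (lower_points V h t)) = (\<Sum>q\<in>?Q. int (card (?F q)))"
    by simp
  also have "\<dots> = (\<Sum>q\<in>?Q. q u - fibre_bound V v u h q - fibre_bound V u v h q + 1)"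
  proof (intro sum.cong refl)
    fix q assume "q \<in> ?Q"
    from fibre_nonempty[OF assms this]
    show "int (card (?F q)) = q u - fibre_bound V v u h q - fibre_bound V u v h q + 1"
      by simp
  qed
  finally show ?thesis .
qed

lemma contract_fun_add_separator:
  "contract_fun V u v (add_separator u v k h) = contract_fun V u v h"
proof
  fix S
  have "u \<in> contract u v -` S \<inter> V \<longleftrightarrow> v \<in> contract u v -` S \<inter> V"
    using u v uv by (simp add: contract_def)
  then show "contract_fun V u v (add_separator u v k h) S = contract_fun V u v h S"
    by (simp add: contract_fun_def add_separator_def)
qed

text \<open>Every set in either maximum contains exactly one of u and v, so all its terms drop by k.
  The two ends of the interval move apart by k each, whence the 2k.\<close>

lemma fibre_bound_add_separator:
  "fibre_bound V u v (add_separator u v k h) q = fibre_bound V u v h q - k"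
  "fibre_bound V v u (add_separator u v k h) q = fibre_bound V v u h q - k"
proof -
  have "fibre_bound V u v (add_separator u v k h) q
      = Max ((\<lambda>R. (- h (insert u R) - sum q R) + (- k)) ` Pow (V - {u, v}))"
    unfolding fibre_bound_def using uv
    by (intro arg_cong[where f = Max] image_cong) (auto simp: add_separator_def)
  then show "fibre_bound V u v (add_separator u v k h) q = fibre_bound V u v h q - k"
    unfolding fibre_bound_def using fin by (subst (asm) Max_add_commute) auto
  have "fibre_bound V v u (add_separator u v k h) q
      = Max ((\<lambda>R. (- h (insert v R) - sum q R) + (- k)) ` Pow (V - {v, u}))"
    unfolding fibre_bound_def using uv
    by (intro arg_cong[where f = Max] image_cong) (auto simp: add_separator_def)
  then show "fibre_bound V v u (add_separator u v k h) q = fibre_bound V v u h q - k"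
    unfolding fibre_bound_def using fin by (subst (asm) Max_add_commute) auto
qed

lemma card_lower_points_add_separator:
  assumes "submodular h" "0 \<le> k"
  shows "int (card (lower_points V (add_separator u v k h) t)) = int (card (lower_points V h t)) +
    2 * k * int (card (lower_points (V - {v}) (contract_fun V u v h) t))"
proof -
  let ?Q = "lower_points (V - {v}) (contract_fun V u v h) t"
  have "int (card (lower_points V (add_separator u v k h) t)) =
      (\<Sum>q\<in>?Q. (q u - fibre_bound V v u h q - fibre_bound V u v h q + 1) + 2 * k)"
    unfolding card_lower_points[OF submodular_add_separator[OF assms]]
      contract_fun_add_separator fibre_bound_add_separator
    by (intro sum.cong refl) linarith
  also have "\<dots> = int (card (lower_points V h t)) + int (card ?Q) * (2 * k)"
    by (simp only: sum.distrib card_lower_points[OF assms(1)] sum_constant of_nat_eq_id)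
  finally show ?thesis
    by (simp only: mult.commute)
qed

text \<open>The geometric counterpart of the count: a point allowed by the additional capacity k is
  a point allowed without it, moved by at most k in direction u - v. This is what lets an edge be
  removed in \<open>point_mem_cone\<close>.\<close>

lemma lower_points_add_separatorE:
  assumes "submodular h" "0 \<le> k" "x \<in> lower_points V (add_separator u v k h) t"
  obtains s where "\<bar>s\<bar> \<le> k" "x(u := x u - s, v := x v + s) \<in> lower_points V h t"
proof -
  let ?q = "merge_coords u v x"
  have x: "\<forall>w. w \<notin> V \<longrightarrow> x w = 0"
    using assms(3) by (simp add: lower_points_def)
  have b: "?q \<in> lower_points (V - {v}) (contract_fun V u v h) t"
    "fibre_bound V u v h ?q - k \<le> x u" "fibre_bound V v u h ?q - k \<le> x v"
    using assms(3)
    unfolding mem_lower_points_iff[OF x] contract_fun_add_separator fibre_bound_add_separator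
    by auto
  have n: "fibre_bound V u v h ?q + fibre_bound V v u h ?q \<le> x u + x v"
    using fibre_nonempty[OF assms(1) b(1)] uv by (simp add: merge_coords_def)
  \<comment> \<open>The smallest transfer that repairs a violated bound by making it tight. The
    other bound then holds as well, since by \<open>n\<close> the two bounds together fit into x u +
    x v.\<close>
  define s where "s = (if x u < fibre_bound V u v h ?q then x u - fibre_bound V u v h ?q
    else if x v < fibre_bound V v u h ?q then fibre_bound V v u h ?q - x v else 0)"
  have s: "\<bar>s\<bar> \<le> k" "fibre_bound V u v h ?q \<le> x u - s" "fibre_bound V v u h ?q \<le> x v + s"
    using b(2,3) n assms(2) by (auto simp: s_def)
  let ?x = "x(u := x u - s, v := x v + s)"
  have "merge_coords u v ?x = ?q"
    using uv by (auto simp: merge_coords_def fun_eq_iff)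
  moreover have "\<forall>w. w \<notin> V \<longrightarrow> ?x w = 0"
    using x u v by auto
  ultimately have "?x \<in> lower_points V h t"
    using mem_lower_points_iff[of ?x h t] s b(1) uv by simp
  with s(1) show ?thesis
    by (rule that)
qed

end

section \<open>Generating functions of cut polyhedra\<close>

definition edge_cut :: "('e \<Rightarrow> 'v \<times> 'v) \<Rightarrow> ('e \<Rightarrow> int) \<Rightarrow> 'e set \<Rightarrow> 'v set \<Rightarrow> int" where
  "edge_cut ends c E S = (\<Sum>f\<in>E. if fst (ends f) \<in> S \<longleftrightarrow> snd (ends f) \<in> S then 0 else c f)"

lemma edge_cut_empty: "edge_cut ends c {} = (\<lambda>_. 0)"
  by (simp add: edge_cut_def fun_eq_iff)

lemma edge_cut_insert:
  assumes "finite E" "f \<notin> E" "ends f = (u, v)"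
  shows "edge_cut ends c (insert f E) = add_separator u v (c f) (edge_cut ends c E)"
  using assms by (simp add: edge_cut_def add_separator_def fun_eq_iff)

lemma add_separator_loop: "add_separator u u k h = h"
  by (simp add: add_separator_def fun_eq_iff)

lemma submodular_edge_cut:
  assumes "finite E" "\<forall>f\<in>E. 0 \<le> c f"
  shows "submodular (edge_cut ends c E)"
  using assms
proof (induction E rule: finite_induct)
  case empty
  then show ?case
    by (simp add: edge_cut_empty submodular_def)
next
  case (insert f E)
  obtain u v where "ends f = (u, v)"
    by fastforce
  then show ?case
    using insert by (simp add: edge_cut_insert submodular_add_separator)
qed

text \<open>An edge is cut by the preimage of S exactly when its contracted copy is cut by S;
  endpoints in V make the restriction to V invisible.\<close>

lemma contract_fun_edge_cut:
  assumes "\<forall>f\<in>E. fst (ends f) \<in> V \<and> snd (ends f) \<in> V"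
  shows "contract_fun V u v (edge_cut ends c E) = edge_cut (contract_ends u v ends) c E"
  unfolding contract_fun_def edge_cut_def
  by (intro ext sum.cong refl) (use assms in simp)

section \<open>The edgeless case: lattice points of dilated simplices\<close>

lemma lower_points_zero:
  assumes "finite V"
  shows "lower_points V (\<lambda>_. 0) t = {x. (\<forall>v. v \<notin> V \<longrightarrow> x v = 0) \<and> sum x V = t \<and> (\<forall>v. 0 \<le> x v)}"
proof -
  have "(\<forall>S\<subseteq>V. 0 \<le> sum x S) \<longleftrightarrow> (\<forall>v. 0 \<le> x v)" if "\<forall>v. v \<notin> V \<longrightarrow> x v = 0" for x :: "'a \<Rightarrow> int"
  proof
    assume *: "\<forall>S\<subseteq>V. 0 \<le> sum x S"
    show "\<forall>v. 0 \<le> x v"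
    proof
      fix v
      show "0 \<le> x v"
        using *[rule_format, of "{v}"] that by (cases "v \<in> V") auto
    qed
  qed (simp add: sum_nonneg)
  then show ?thesis
    unfolding lower_points_def by auto
qed

text \<open>Split by x v = 0 or x v > 0, lowering x v by one in the second case. For the series this
  says that the additional vertex costs a factor 1/(1 - z).\<close>

lemma card_lower_points_zero_insert:
  assumes "finite V" "v \<notin> V"
  shows "card (lower_points (insert v V) (\<lambda>_. 0) t) =
    card (lower_points V (\<lambda>_. 0) t) + card (lower_points (insert v V) (\<lambda>_. 0) (t - 1))"
proof -
  let ?L = "\<lambda>V t. lower_points V (\<lambda>_. 0 :: int) t"
  have s: "sum x (insert v V) = x v + sum x V" for x :: "'a \<Rightarrow> int"
    using assms by simp
  have upd: "sum (x(v := a)) V = sum x V" for x :: "'a \<Rightarrow> int" and a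
    using assms by (intro sum.cong) auto
  have fin: "finite (insert v V)"
    using assms by simp
  have "?L (insert v V) t = ?L V t \<union> (\<lambda>x. x(v := x v + 1)) ` ?L (insert v V) (t - 1)" (is "?l = ?r")
  proof (intro equalityI subsetI)
    fix x assume x: "x \<in> ?l"
    show "x \<in> ?r"
    proof (cases "x v = 0")
      case True
      then show ?thesis
        using x unfolding lower_points_zero[OF fin] lower_points_zero[OF assms(1)] s by auto
    next
      case False
      then have "0 \<le> x v - 1"
        using x unfolding lower_points_zero[OF fin] by (auto simp: order_less_le)
      then have "x(v := x v - 1) \<in> ?L (insert v V) (t - 1)"
        using x unfolding lower_points_zero[OF fin] s mem_Collect_eq upd by auto
      then show ?thesis
        by (intro UnI2 image_eqI[of _ _ "x(v := x v - 1)"]) auto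
    qed
  next
    fix x assume "x \<in> ?r"
    then show "x \<in> ?l"
    proof
      assume "x \<in> ?L V t"
      then show ?thesis
        using assms unfolding lower_points_zero[OF fin] lower_points_zero[OF assms(1)] s by auto
    next
      assume "x \<in> (\<lambda>x. x(v := x v + 1)) ` ?L (insert v V) (t - 1)"
      then obtain y where "y \<in> ?L (insert v V) (t - 1)" "x = y(v := y v + 1)"
        by blast
      then show ?thesis
        using upd[of y "y v + 1"] unfolding lower_points_zero[OF fin] s mem_Collect_eq by auto
    qed
  qed
  moreover have "?L V t \<inter> (\<lambda>x. x(v := x v + 1)) ` ?L (insert v V) (t - 1) = {}"
  proof -
    have "y v + 1 > 0" if "y \<in> ?L (insert v V) (t - 1)" for y
      using that unfolding lower_points_zero[OF fin] by (simp add: add.commute add_pos_nonneg)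
    moreover have "x v = 0" if "x \<in> ?L V t" for x
      using that assms(2) by (simp add: lower_points_def)
    ultimately show ?thesis
      by fastforce
  qed
  moreover have "inj_on (\<lambda>x. x(v := x v + 1)) (?L (insert v V) (t - 1))"
    by (rule inj_onI) (metis add_right_cancel fun_upd_same fun_upd_triv fun_upd_upd)
  moreover note finite_lower_points[OF assms(1)] finite_lower_points[OF fin]
  ultimately show ?thesis
    by (simp add: card_Un_disjoint card_image)
qed

definition cut_series :: "'v set \<Rightarrow> ('e \<Rightarrow> 'v \<times> 'v) \<Rightarrow> ('e \<Rightarrow> int) \<Rightarrow> 'e set \<Rightarrow> int fps" where
  "cut_series V ends c E = Abs_fps (\<lambda>t. int (card (lower_points V (edge_cut ends c E) (int t))))"

lemma cut_series_empty:
  assumes "finite V"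
  shows "(1 - fps_X) ^ card V * cut_series V ends c {} = 1"
  using assms
proof (induction V rule: finite_induct)
  case empty
  have "lower_points {} (\<lambda>_::'a set. 0) t = (if t = 0 then {\<lambda>_. 0} else {})" for t
    by (auto simp: lower_points_def)
  then show ?case
    by (intro fps_ext) (simp add: cut_series_def edge_cut_empty)
next
  case (insert v V)
  have "(1 - fps_X) * cut_series (insert v V) ends c {} = cut_series V ends c {}"
  proof (rule fps_ext)
    fix t
    \<comment> \<open>Multiplication by z puts 0 at index 0, which has to match the integer level
      -1.\<close>
    have neg: "lower_points (insert v V) (\<lambda>_. 0) (int t - 1) = {}" if "t = 0"
      using that insert.hyps(1) by (auto simp: lower_points_zero) (smt (verit) sum_nonneg sum.insert insert.hyps)
    have "fps_nth (fps_X * cut_series (insert v V) ends c {}) t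
        = int (card (lower_points (insert v V) (\<lambda>_. 0) (int t - 1)))"
      using neg by (cases t) (simp_all add: fps_X_mult_nth cut_series_def edge_cut_empty)
    then show "fps_nth ((1 - fps_X) * cut_series (insert v V) ends c {}) t = fps_nth (cut_series V ends c {}) t"
      using card_lower_points_zero_insert[OF insert.hyps, of "int t"]
      by (simp add: left_diff_distrib cut_series_def edge_cut_empty)
  qed
  then have "(1 - fps_X) ^ card (insert v V) * cut_series (insert v V) ends c {} =
      (1 - fps_X) ^ card V * cut_series V ends c {}"
    using insert.hyps by (simp add: power_Suc2 mult.assoc del: power_Suc)
  with insert.IH show ?case
    by simp
qed

section \<open>Deletion and contraction for the series\<close>

lemma sum_acyclic_insert:
  assumes "finite E" "f \<notin> E"
  shows "(\<Sum>H | H \<subseteq> insert f E \<and> \<not> has_cycle ends H. g H) =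
    (\<Sum>H | H \<subseteq> E \<and> \<not> has_cycle ends H. g H) +
    (\<Sum>H | H \<subseteq> E \<and> \<not> has_cycle ends (insert f H). g (insert f H) :: 'a::comm_monoid_add)"
proof -
  let ?A = "{H. H \<subseteq> E \<and> \<not> has_cycle ends H}"
  let ?B = "{H. H \<subseteq> E \<and> \<not> has_cycle ends (insert f H)}"
  have eq: "{H. H \<subseteq> insert f E \<and> \<not> has_cycle ends H} = ?A \<union> insert f ` ?B"
  proof (intro equalityI subsetI)
    fix H assume H: "H \<in> {H. H \<subseteq> insert f E \<and> \<not> has_cycle ends H}"
    show "H \<in> ?A \<union> insert f ` ?B"
    proof (cases "f \<in> H")
      case True
      then have "H = insert f (H - {f})" "H - {f} \<in> ?B"
        using H by (auto simp: insert_absorb)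
      then show ?thesis
        by blast
    qed (use H in auto)
  qed auto
  have inj: "inj_on (insert f) ?B"
    using assms(2) by (intro inj_onI) (metis (no_types, lifting) insert_ident mem_Collect_eq subset_iff)
  have fin: "finite ?A" "finite ?B"
    using assms(1) by auto
  show ?thesis
    unfolding eq using fin assms(2)
    by (subst sum.union_disjoint) (auto simp: sum.reindex[OF inj])
qed

theorem cut_series_eq:
  assumes "finite E" "finite V" "\<forall>f\<in>E. fst (ends f) \<in> V \<and> snd (ends f) \<in> V" "\<forall>f\<in>E. 0 \<le> c f"
  shows "(1 - fps_X) ^ card V * cut_series V ends c E =
    (\<Sum>H | H \<subseteq> E \<and> \<not> has_cycle ends H. \<Prod>f\<in>H. fps_const (2 * c f) * (1 - fps_X))"
  using assms
proof (induction E arbitrary: V ends rule: finite_induct)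
  case empty
  have "{H. H \<subseteq> {} \<and> \<not> has_cycle ends H} = {{}}"
    by (auto simp: not_has_cycle_empty)
  then show ?case
    using cut_series_empty empty by simp
next
  case (insert f E)
  let ?g = "\<lambda>H. \<Prod>f\<in>H. fps_const (2 * c f) * (1 - fps_X :: int fps)"
  obtain u v where uv: "ends f = (u, v)"
    by fastforce
  have uV: "u \<in> V" "v \<in> V"
    using insert.prems(2) uv by auto
  have IH: "(1 - fps_X) ^ card V * cut_series V ends c E =
      (\<Sum>H | H \<subseteq> E \<and> \<not> has_cycle ends H. ?g H)"
    using insert by simp
  show ?case
  proof (cases "u = v")
    case True
    \<comment> \<open>A loop lies in no forest and in no cut, so both sides ignore it.\<close>
    have "has_cycle ends (insert f H)" for H
      using has_cycle_insertI[of ends f "{}"] uv True has_cycle_mono[of ends "{f}" "insert f H"]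
      by simp
    then show ?thesis
      unfolding sum_acyclic_insert[OF insert.hyps]
      using IH insert.hyps uv True
      by (simp add: cut_series_def edge_cut_insert add_separator_loop)
  next
    case False
    let ?V = "V - {v}" and ?e = "contract_ends u v ends"
    have series: "cut_series V ends c (insert f E) =
        cut_series V ends c E + fps_const (2 * c f) * cut_series ?V ?e c E"
    proof (rule fps_ext)
      fix t
      have "0 \<le> c f" and sub: "submodular (edge_cut ends c E)"
        using insert by (simp_all add: submodular_edge_cut)
      moreover have "contract_fun V u v (edge_cut ends c E) = edge_cut ?e c E"
        using insert.prems by (intro contract_fun_edge_cut) simp
      ultimately show "fps_nth (cut_series V ends c (insert f E)) t =
          fps_nth (cut_series V ends c E + fps_const (2 * c f) * cut_series ?V ?e c E) t"
        using card_lower_points_add_separator[OF insert.prems(1) uV False sub, of "c f" "int t"]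
          insert.hyps uv
        by (simp add: cut_series_def edge_cut_insert)
    qed
    have "(1 - fps_X) ^ card ?V * cut_series ?V ?e c E =
        (\<Sum>H | H \<subseteq> E \<and> \<not> has_cycle ?e H. ?g H)"
      using insert.prems uV False by (intro insert.IH) (auto simp: contract_def)
    also have "{H. H \<subseteq> E \<and> \<not> has_cycle ?e H} = {H. H \<subseteq> E \<and> \<not> has_cycle ends (insert f H)}"
      using has_cycle_contract[of ends f u v, OF uv False] insert.hyps by (auto dest: finite_subset)
    finally have IH': "(1 - fps_X) ^ card ?V * cut_series ?V ?e c E =
        (\<Sum>H | H \<subseteq> E \<and> \<not> has_cycle ends (insert f H). ?g H)" .
    \<comment> \<open>Contraction loses one vertex, so the normalising power leaves one spare factor
      1 - z; it becomes the factor attached to \<open>f\<close>.\<close>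
    have "card V = Suc (card ?V)"
      using uV insert.prems(1) by (intro card_Suc_Diff1[symmetric])
    then have "(1 - fps_X) ^ card V * cut_series V ends c (insert f E) =
        (1 - fps_X) ^ card V * cut_series V ends c E + fps_const (2 * c f) * (1 - fps_X) *
        ((1 - fps_X) ^ card ?V * cut_series ?V ?e c E)"
      unfolding series by (simp only: power_Suc distrib_left ac_simps)
    also have "\<dots> = (\<Sum>H | H \<subseteq> E \<and> \<not> has_cycle ends H. ?g H) +
        (\<Sum>H | H \<subseteq> E \<and> \<not> has_cycle ends (insert f H). ?g (insert f H))"
    proof -
      have "?g (insert f H) = fps_const (2 * c f) * (1 - fps_X) * ?g H" if "H \<subseteq> E" for H
        using that insert.hyps finite_subset by (subst prod.insert) auto
      then show ?thesis
        unfolding IH IH' by (simp add: sum_distrib_left)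
    qed
    also have "\<dots> = (\<Sum>H | H \<subseteq> insert f E \<and> \<not> has_cycle ends H. ?g H)"
      by (rule sum_acyclic_insert[OF insert.hyps, symmetric])
    finally show ?thesis .
  qed
qed

section \<open>The cone over the cosmological polytope\<close>

lemma ev_nth [simp]:
  "ev u $ Inl w = (if w = u then 1 else 0)" "ev u $ Inr f = 0"
  by (simp_all add: ev_def axis_def)

lemma ee_nth [simp]:
  "ee f $ Inl w = 0" "ee f $ Inr g = (if g = f then 1 else 0)"
  by (simp_all add: ee_def axis_def)

definition point :: "'e set \<Rightarrow> ('v \<Rightarrow> int) \<Rightarrow> ('e \<Rightarrow> int) \<Rightarrow> real ^ ('v::finite + 'e::finite)" where
  "point E a y = (\<chi> i. case i of Inl w \<Rightarrow> of_int (a w) | Inr f \<Rightarrow> if f \<in> E then of_int (y f) else 0)"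

lemma point_nth [simp]:
  "point E a y $ Inl w = of_int (a w)"
  "point E a y $ Inr f = (if f \<in> E then of_int (y f) else 0)"
  by (simp_all add: point_def)

lemma vec_sum_eqI:
  fixes x y :: "'a ^ ('v::finite + 'e::finite)"
  assumes "\<And>w. x $ Inl w = y $ Inl w" "\<And>f. x $ Inr f = y $ Inr f"
  shows "x = y"
  unfolding vec_eq_iff using assms by (metis sum.exhaust)

lemma convex_cone_sum_mem:
  assumes "convex_cone C" "\<And>i. i \<in> I \<Longrightarrow> f i \<in> C"
  shows "sum f I \<in> C"
  using assms(2)
  by (induction I rule: infinite_finite_induct)
    (auto simp: assms(1) convex_cone_contains_0 convex_cone_add)

text \<open>The cone \<open>C\<close> is abstract so that it stays fixed while the induction shrinks
  the edge set. Without edges the point is a nonnegative combination of vertex vectors; each edge is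
  then accounted for by its own generators.\<close>

lemma point_mem_cone:
  fixes C :: "(real ^ ('v::finite + 'e::finite)) set"
  assumes C: "convex_cone C" "\<And>u. u \<in> V \<Longrightarrow> ev u \<in> C"
    and "\<And>f. f \<in> E \<Longrightarrow> fst (ends f) \<in> V \<and> snd (ends f) \<in> V"
    and "\<And>f. f \<in> E \<Longrightarrow> ee f \<in> C"
    and "\<And>f. f \<in> E \<Longrightarrow> ev (fst (ends f)) - ev (snd (ends f)) + ee f \<in> C"
    and "\<And>f. f \<in> E \<Longrightarrow> - ev (fst (ends f)) + ev (snd (ends f)) + ee f \<in> C"
    and "\<And>f. f \<in> E \<Longrightarrow> 0 \<le> c f"
    and "x \<in> lower_points V (edge_cut ends c E) t"
  shows "point E x c \<in> C"
proof -
  have "finite E"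
    by simp
  then show ?thesis
    using assms(3-)
  proof (induction E arbitrary: x rule: finite_induct)
    case empty
    have x: "0 \<le> x w" "w \<notin> V \<Longrightarrow> x w = 0" for w
      using empty(6) by (simp_all add: edge_cut_empty lower_points_zero)
    have "point {} x c = (\<Sum>u\<in>V. of_int (x u) *\<^sub>R ev u)"
      using x(2) by (intro vec_sum_eqI) (auto simp: if_distrib cong: if_cong)
    also have "\<dots> \<in> C"
      by (intro convex_cone_sum_mem[OF C(1)] convex_cone_scaleR[OF C(1)] C(2)) (use x in auto)
    finally show ?case .
  next
    case (insert f E)
    obtain u v where uv: "ends f = (u, v)"
      by fastforce
    have V: "u \<in> V" "v \<in> V" and c: "0 \<le> c f"
      using insert.prems(1)[of f] insert.prems(5)[of f] uv by simp_all
    have sub: "submodular (edge_cut ends c E)"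
      using insert by (intro submodular_edge_cut) auto
    have x: "x \<in> lower_points V (add_separator u v (c f) (edge_cut ends c E)) t"
      using insert.prems(6) insert.hyps uv by (simp add: edge_cut_insert)
    have IH: "point E x' c \<in> C" if "x' \<in> lower_points V (edge_cut ends c E) t" for x'
      using insert.prems that by (intro insert.IH) auto
    show ?case
    proof (cases "u = v")
      case True
      have "point (insert f E) x c = point E x c + of_int (c f) *\<^sub>R ee f"
        using insert.hyps by (intro vec_sum_eqI) auto
      moreover have "ee f \<in> C"
        using insert.prems(2) by simp
      ultimately show ?thesis
        using IH[of x] x True c C(1)
        by (simp add: add_separator_loop convex_cone_add convex_cone_scaleR)
    next
      case False
      obtain s where s: "\<bar>s\<bar> \<le> c f"
        "x(u := x u - s, v := x v + s) \<in> lower_points V (edge_cut ends c E) t"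
        using lower_points_add_separatorE[OF finite[of V] V False sub c x] by blast
      let ?x = "x(u := x u - s, v := x v + s)"
      have "point (insert f E) x c = point E ?x c
          + (of_int (c f + s) / 2) *\<^sub>R (ev u - ev v + ee f)
          + (of_int (c f - s) / 2) *\<^sub>R (- ev u + ev v + ee f)"
        using insert.hyps False by (intro vec_sum_eqI) (auto simp: field_simps)
      moreover have "ev u - ev v + ee f \<in> C" "- ev u + ev v + ee f \<in> C"
        using insert.prems(3,4)[of f] uv by simp_all
      moreover have "0 \<le> (of_int (c f + s) / 2 :: real)" "0 \<le> (of_int (c f - s) / 2 :: real)"
        using s(1) by simp_all
      ultimately show ?thesis
        using IH[OF s(2)] by (simp only: convex_cone_add[OF C(1)] convex_cone_scaleR[OF C(1)])
    qed
  qed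
qed

section \<open>Valid inequalities for the cone\<close>

text \<open>The vertex part of the combination of generators e_u + e_v - e_f that produces the
  negative entries of y.\<close>

definition shift :: "('e \<Rightarrow> 'v \<times> 'v) \<Rightarrow> 'e set \<Rightarrow> ('e \<Rightarrow> int) \<Rightarrow> 'v \<Rightarrow> int" where
  "shift ends E y w = (\<Sum>f\<in>E. max (- y f) 0 * (of_bool (fst (ends f) = w) + of_bool (snd (ends f) = w)))"

lemma sum_shift:
  assumes "finite S"
  shows "sum (shift ends E y) S =
    (\<Sum>f\<in>E. max (- y f) 0 * (of_bool (fst (ends f) \<in> S) + of_bool (snd (ends f) \<in> S)))"
proof -
  have "sum (shift ends E y) S = (\<Sum>f\<in>E. \<Sum>w\<in>S.
      max (- y f) 0 * (of_bool (fst (ends f) = w) + of_bool (snd (ends f) = w)))"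
    unfolding shift_def by (rule sum.swap)
  also have "\<dots> = (\<Sum>f\<in>E. max (- y f) 0 * (of_bool (fst (ends f) \<in> S) + of_bool (snd (ends f) \<in> S)))"
  proof (intro sum.cong refl)
    fix f
    have "(\<Sum>w\<in>S. of_bool (z = w)) = (of_bool (z \<in> S) :: int)" for z
      using assms by (simp add: of_bool_def)
    then show "(\<Sum>w\<in>S. max (- y f) 0 * (of_bool (fst (ends f) = w) + of_bool (snd (ends f) = w))) =
        max (- y f) 0 * (of_bool (fst (ends f) \<in> S) + of_bool (snd (ends f) \<in> S))"
      by (simp add: sum.distrib flip: sum_distrib_left)
  qed
  finally show ?thesis .
qed

text \<open>This is 0, r or 2 min(r, 0) according to how many endpoints of the edge lie in S; each
  is concave and positively homogeneous in r, so the inequalities cut out a convex cone.\<close>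

definition edge_defect :: "bool \<Rightarrow> bool \<Rightarrow> real \<Rightarrow> real" where
  "edge_defect p q r = (if p = q then 0 else max r 0) - max (- r) 0 * (of_bool p + of_bool q)"

lemma edge_defect_superadditive:
  "edge_defect p q r + edge_defect p q s \<le> edge_defect p q (r + s)"
proof (cases "p = q")
  case True
  have "max (- (r + s)) 0 \<le> max (- r) 0 + max (- s) 0"
    by linarith
  then have "max (- (r + s)) 0 * (of_bool p + of_bool q)
      \<le> (max (- r) 0 + max (- s) 0) * (of_bool p + of_bool q)"
    by (rule mult_right_mono) simp
  then show ?thesis
    unfolding edge_defect_def True distrib_right by simp
next
  case False
  then have "of_bool p + of_bool q = (1 :: real)"
    by (cases p; cases q) simp_all
  moreover have "max z 0 - max (- z) 0 = z" for z :: real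
    by linarith
  ultimately have "edge_defect p q z = z" for z
    using False by (simp only: edge_defect_def if_False mult_1_right)
  then show ?thesis
    by simp
qed

lemma edge_defect_scale:
  assumes "0 \<le> c"
  shows "edge_defect p q (c * r) = c * edge_defect p q r"
proof -
  have "max (c * r) 0 = c * max r 0" "max (- (c * r)) 0 = c * max (- r) 0"
    using assms by (simp_all add: max_mult_distrib_left)
  then show ?thesis
    by (simp add: edge_defect_def right_diff_distrib mult.assoc)
qed

lemma edge_defect_zero [simp]: "edge_defect p q 0 = 0"
  by (simp add: edge_defect_def)

definition cone_ineq :: "('e \<Rightarrow> 'v \<times> 'v) \<Rightarrow> 'e set \<Rightarrow> 'v set \<Rightarrow> real ^ ('v::finite + 'e::finite) \<Rightarrow> real" where
  "cone_ineq ends E S x = (\<Sum>u\<in>S. x $ Inl u) +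
     (\<Sum>f\<in>E. edge_defect (fst (ends f) \<in> S) (snd (ends f) \<in> S) (x $ Inr f))"

definition outer_cone :: "'v set \<Rightarrow> ('e \<Rightarrow> 'v \<times> 'v) \<Rightarrow> 'e set \<Rightarrow> (real ^ ('v::finite + 'e::finite)) set" where
  "outer_cone V ends E = {x. (\<forall>w. w \<notin> V \<longrightarrow> x $ Inl w = 0) \<and> (\<forall>f. f \<notin> E \<longrightarrow> x $ Inr f = 0) \<and>
     (\<forall>S\<subseteq>V. 0 \<le> cone_ineq ends E S x)}"

lemma convex_cone_outer_cone: "convex_cone (outer_cone V ends E)"
proof -
  have "cone_ineq ends E S x + cone_ineq ends E S y \<le> cone_ineq ends E S (x + y)" for S x y
  proof -
    have "(\<Sum>f\<in>E. edge_defect (fst (ends f) \<in> S) (snd (ends f) \<in> S) (x $ Inr f)) +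
        (\<Sum>f\<in>E. edge_defect (fst (ends f) \<in> S) (snd (ends f) \<in> S) (y $ Inr f)) \<le>
        (\<Sum>f\<in>E. edge_defect (fst (ends f) \<in> S) (snd (ends f) \<in> S) ((x + y) $ Inr f))"
      unfolding sum.distrib[symmetric] vector_add_component
      by (intro sum_mono edge_defect_superadditive)
    then show ?thesis
      by (simp add: cone_ineq_def sum.distrib)
  qed
  then have add: "0 \<le> cone_ineq ends E S (x + y)"
    if "0 \<le> cone_ineq ends E S x" "0 \<le> cone_ineq ends E S y" for S x y
    using that by (meson add_nonneg_nonneg order_trans)
  have scale: "cone_ineq ends E S (c *\<^sub>R x) = c * cone_ineq ends E S x" if "0 \<le> c" for S x c
    using that by (simp add: cone_ineq_def edge_defect_scale sum_distrib_left distrib_left)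
  have "cone_ineq ends E S 0 = 0" for S
    by (simp add: cone_ineq_def)
  with add scale show ?thesis
    by (auto simp: convex_cone_iff outer_cone_def)
qed

text \<open>The bridge between the two coordinate systems: the sum of the shift over S is precisely
  the part that \<open>edge_defect\<close> subtracts, so the cut constraint with capacities max (y
  f) 0 remains.\<close>

lemma cone_ineq_point:
  "cone_ineq ends E S (point E (\<lambda>w. a w + shift ends E y w) y) =
    of_int (sum a S + edge_cut ends (\<lambda>f. max (y f) 0) E S)"
proof -
  have "cone_ineq ends E S (point E (\<lambda>w. a w + shift ends E y w) y) =
      of_int (sum a S) + of_int (sum (shift ends E y) S) +
      (\<Sum>f\<in>E. edge_defect (fst (ends f) \<in> S) (snd (ends f) \<in> S) (of_int (y f)))"
    by (simp add: cone_ineq_def sum.distrib)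
  also have "(\<Sum>f\<in>E. edge_defect (fst (ends f) \<in> S) (snd (ends f) \<in> S) (of_int (y f))) =
      of_int (edge_cut ends (\<lambda>f. max (y f) 0) E S) - of_int (sum (shift ends E y) S)"
    unfolding sum_shift[OF finite] edge_cut_def of_int_sum sum_subtractf[symmetric]
    by (intro sum.cong refl) (simp add: edge_defect_def max_def)
  finally show ?thesis
    by simp
qed

section \<open>Generators, dimension and coordinate sum\<close>

lemma cosmological_polytope_generators:
  "u \<in> V \<Longrightarrow> ev u \<in> cosmological_polytope V E ends"
  "f \<in> E \<Longrightarrow> {ee f, ev (fst (ends f)) + ev (snd (ends f)) - ee f,
    ev (fst (ends f)) - ev (snd (ends f)) + ee f,
    - ev (fst (ends f)) + ev (snd (ends f)) + ee f} \<subseteq> cosmological_polytope V E ends"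
proof -
  show "u \<in> V \<Longrightarrow> ev u \<in> cosmological_polytope V E ends"
    unfolding cosmological_polytope_def by (intro hull_inc UnI2 imageI)
  show "f \<in> E \<Longrightarrow> {ee f, ev (fst (ends f)) + ev (snd (ends f)) - ee f,
    ev (fst (ends f)) - ev (snd (ends f)) + ee f,
    - ev (fst (ends f)) + ev (snd (ends f)) + ee f} \<subseteq> cosmological_polytope V E ends"
    unfolding cosmological_polytope_def Let_def
    by (intro order_trans[OF _ hull_subset] le_supI1 SUP_upper2[of f] order_refl)
qed

lemma cosmological_polytope_subsetI:
  assumes "convex C" "\<And>u. u \<in> V \<Longrightarrow> ev u \<in> C"
    "\<And>f. f \<in> E \<Longrightarrow> {ee f, ev (fst (ends f)) + ev (snd (ends f)) - ee f,
      ev (fst (ends f)) - ev (snd (ends f)) + ee f,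
      - ev (fst (ends f)) + ev (snd (ends f)) + ee f} \<subseteq> C"
  shows "cosmological_polytope V E ends \<subseteq> C"
  unfolding cosmological_polytope_def
proof (rule hull_minimal)
  show "convex C"
    by (rule assms(1))
qed (unfold Let_def, intro Un_least UN_least image_subsetI assms(2,3))

text \<open>Every generator is a unit vector or has the form p + q - r with unit vectors p, q, r, so
  the affine hull is that of the linearly independent vectors \<open>ev u\<close> and
  \<open>ee f\<close>.\<close>

lemma aff_dim_cosmological_polytope:
  fixes V :: "'v::finite set" and E :: "'e::finite set"
  assumes ends: "\<forall>f\<in>E. fst (ends f) \<in> V \<and> snd (ends f) \<in> V"
  shows "aff_dim (cosmological_polytope V E ends) + 1 = int (card V + card E)"
proof -
  define B :: "(real ^ ('v + 'e)) set" where "B = ev ` V \<union> ee ` E"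
  have "B \<subseteq> Basis"
    by (auto simp: B_def ev_def ee_def axis_in_Basis_iff)
  then have "independent B"
    using independent_Basis independent_mono by blast
  then have "\<not> affine_dependent B"
    using affine_dependent_imp_dependent by blast
  then have "int (card B) = aff_dim B + 1"
    by (rule aff_dim_affine_independent)
  moreover have "card B = card V + card E"
  proof -
    have "inj_on (ev :: 'v \<Rightarrow> real ^ ('v + 'e)) V" "inj_on (ee :: 'e \<Rightarrow> real ^ ('v + 'e)) E"
      by (auto simp: inj_on_def ev_def ee_def axis_eq_axis)
    moreover have "(ev ` V :: (real ^ ('v + 'e)) set) \<inter> ee ` E = {}"
      by (auto simp: ev_def ee_def axis_eq_axis)
    ultimately show ?thesis
      unfolding B_def by (simp add: card_Un_disjoint card_image)
  qed
  moreover have "affine hull (cosmological_polytope V E ends) = affine hull B"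
  proof
    have "B \<subseteq> cosmological_polytope V E ends"
      using cosmological_polytope_generators(1)[of _ V E ends]
        cosmological_polytope_generators(2)[of _ E ends V] by (auto simp: B_def)
    then show "affine hull B \<subseteq> affine hull (cosmological_polytope V E ends)"
      by (rule hull_mono)
    have ev: "ev u \<in> affine hull B" if "u \<in> V" for u
      using that by (intro hull_inc) (auto simp: B_def)
    have ee: "ee f \<in> affine hull B" if "f \<in> E" for f
      using that by (intro hull_inc) (auto simp: B_def)
    have "cosmological_polytope V E ends \<subseteq> affine hull B"
    proof (rule cosmological_polytope_subsetI)
      fix f assume f: "f \<in> E"
      let ?u = "ev (fst (ends f)) :: real ^ ('v + 'e)" and ?v = "ev (snd (ends f)) :: real ^ ('v + 'e)"
      have m: "?u \<in> affine hull B" "?v \<in> affine hull B" "ee f \<in> affine hull B"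
        using ev ee f ends by auto
      have "?u + 1 *\<^sub>R (?v - ee f) \<in> affine hull B" "ee f + 1 *\<^sub>R (?u - ?v) \<in> affine hull B"
        "ee f + 1 *\<^sub>R (?v - ?u) \<in> affine hull B"
        by (intro mem_affine_3_minus affine_affine_hull m)+
      then show "{ee f, ?u + ?v - ee f, ?u - ?v + ee f, - ?u + ?v + ee f} \<subseteq> affine hull B"
        using m(3) by (simp add: algebra_simps)
    qed (use ev in \<open>auto intro: affine_imp_convex affine_affine_hull\<close>)
    then show "affine hull (cosmological_polytope V E ends) \<subseteq> affine hull B"
      by (simp add: hull_minimal affine_affine_hull)
  qed
  ultimately show ?thesis
    by (metis aff_dim_affine_hull)
qed

text \<open>Puts the polytope at height 1 of its cone, so that the dilation factor of a point of the
  cone can be read off from its coordinates.\<close>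

lemma coordinate_sum_cosmological_polytope:
  fixes V :: "'v::finite set" and E :: "'e::finite set"
  assumes "x \<in> cosmological_polytope V E ends"
  shows "(\<Sum>i\<in>UNIV. x $ i) = 1"
proof -
  have "convex {x :: real ^ ('v + 'e). (\<Sum>i\<in>UNIV. x $ i) = 1}"
    by (auto simp: convex_def sum.distrib simp flip: sum_distrib_left)
  moreover have "(\<Sum>i\<in>UNIV. (ev u :: real ^ ('v + 'e)) $ i) = 1"
      "(\<Sum>i\<in>UNIV. (ee f :: real ^ ('v + 'e)) $ i) = 1" for u f
    by (simp_all add: ev_def ee_def axis_def)
  ultimately have "cosmological_polytope V E ends \<subseteq> {x. (\<Sum>i\<in>UNIV. x $ i) = 1}"
    by (intro cosmological_polytope_subsetI) (auto simp: sum.distrib sum_subtractf sum_negf)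
  then show ?thesis
    using assms by blast
qed

lemma cosmological_polytope_subset_outer_cone:
  fixes V :: "'v::finite set" and E :: "'e::finite set"
  assumes ends: "\<forall>f\<in>E. fst (ends f) \<in> V \<and> snd (ends f) \<in> V"
  shows "cosmological_polytope V E ends \<subseteq> outer_cone V ends E"
proof (rule cosmological_polytope_subsetI)
  show "convex (outer_cone V ends E)"
    using convex_cone_outer_cone unfolding convex_cone_def by blast
  have "cone_ineq ends E S (ev u) = of_bool (u \<in> S)" for S u
    by (simp add: cone_ineq_def of_bool_def)
  then show "ev u \<in> outer_cone V ends E" if "u \<in> V" for u
    using that by (auto simp: outer_cone_def)
  fix f assume f: "f \<in> E"
  let ?u = "fst (ends f)" and ?v = "snd (ends f)"
  have uv: "?u \<in> V" "?v \<in> V"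
    using ends f by auto
  \<comment> \<open>All generators of an edge have this shape, and an inequality sees S only through
    the membership of the two endpoints. Four Boolean cases remain; loops need no separate
    argument.\<close>
  have gen: "p *\<^sub>R ev ?u + q *\<^sub>R ev ?v + r *\<^sub>R ee f \<in> outer_cone V ends E" (is "?x \<in> _")
    if "\<And>i j. 0 \<le> p * of_bool i + q * of_bool j + edge_defect i j r" for p q r
  proof -
    have "0 \<le> cone_ineq ends E S ?x" for S
    proof -
      have "(\<Sum>g\<in>E. edge_defect (fst (ends g) \<in> S) (snd (ends g) \<in> S) (?x $ Inr g)) =
          (\<Sum>g\<in>E. if g = f then edge_defect (?u \<in> S) (?v \<in> S) r else 0)"
        by (intro sum.cong) auto
      moreover have "(\<Sum>w\<in>S. ?x $ Inl w) = p * of_bool (?u \<in> S) + q * of_bool (?v \<in> S)"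
        by (simp add: sum.distrib of_bool_def flip: sum_distrib_left)
      ultimately show ?thesis
        using f that by (simp add: cone_ineq_def)
    qed
    then show ?thesis
      using uv f by (auto simp: outer_cone_def)
  qed
  have "0 *\<^sub>R ev ?u + 0 *\<^sub>R ev ?v + 1 *\<^sub>R ee f \<in> outer_cone V ends E"
    "1 *\<^sub>R ev ?u + 1 *\<^sub>R ev ?v + (- 1) *\<^sub>R ee f \<in> outer_cone V ends E"
    "1 *\<^sub>R ev ?u + (- 1) *\<^sub>R ev ?v + 1 *\<^sub>R ee f \<in> outer_cone V ends E"
    "(- 1) *\<^sub>R ev ?u + 1 *\<^sub>R ev ?v + 1 *\<^sub>R ee f \<in> outer_cone V ends E"
    by (rule gen, simp add: edge_defect_def)+
  then show "{ee f, ev ?u + ev ?v - ee f, ev ?u - ev ?v + ee f, - ev ?u + ev ?v + ee f}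
      \<subseteq> outer_cone V ends E"
    by simp
qed

section \<open>Ehrhart series\<close>

text \<open>A negative entry y f contributes 2 |y f| through the shift and -|y f| through its own
  coordinate, hence |y f| in total, just as a positive entry does.\<close>

lemma coordinate_sum_point:
  fixes a :: "'v::finite \<Rightarrow> int" and E :: "'e::finite set"
  assumes "\<And>w. w \<notin> V \<Longrightarrow> a w = 0"
  shows "(\<Sum>i\<in>UNIV. point E (\<lambda>w. a w + shift ends E y w) y $ i) =
    of_int (sum a V + (\<Sum>f\<in>E. \<bar>y f\<bar>))"
proof -
  let ?x = "point E (\<lambda>w. a w + shift ends E y w) y"
  have "(\<Sum>i\<in>UNIV. ?x $ i) = (\<Sum>w\<in>UNIV. ?x $ Inl w) + (\<Sum>f\<in>UNIV. ?x $ Inr f)"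
    by (simp add: UNIV_Plus_UNIV[symmetric] sum.Plus comp_def del: UNIV_Plus_UNIV)
  also have "\<dots> = of_int (sum a UNIV + (sum (shift ends E y) UNIV + sum y E))"
    by (simp add: sum.distrib sum.If_cases)
  also have "sum a UNIV = sum a V"
    by (rule sum.mono_neutral_right) (use assms in auto)
  also have "sum (shift ends E y) UNIV + sum y E = (\<Sum>f\<in>E. \<bar>y f\<bar>)"
    unfolding sum_shift[OF finite] sum.distrib[symmetric] by (intro sum.cong) auto
  finally show ?thesis .
qed

text \<open>No edge leaves V, so the constraint at S = V says that the total is nonnegative.\<close>

lemma lower_points_edge_cut_empty:
  assumes "\<forall>f\<in>E. fst (ends f) \<in> V \<and> snd (ends f) \<in> V" "t < 0"
  shows "lower_points V (edge_cut ends c E) t = {}"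
proof -
  have "edge_cut ends c E V = 0"
    unfolding edge_cut_def by (intro sum.neutral) (use assms(1) in simp)
  then show ?thesis
    using assms(2) by (force simp: lower_points_def)
qed

lemma convex_cone_conic_hull:
  assumes "convex S" "S \<noteq> {}"
  shows "convex_cone (conic hull S)"
proof -
  have "conic hull S \<noteq> {}"
    using assms(2) hull_subset[of S conic] by blast
  then show ?thesis
    using assms(1) by (simp add: convex_cone_def convex_conic_hull conic_conic_hull)
qed

text \<open>Split y into positive and negative part: the former is handled by
  \<open>point_mem_cone\<close>, the latter by multiples of e_u + e_v - e_f, whose vertex part is
  the shift.\<close>

lemma point_shift_mem_conic_hull:
  fixes V :: "'v::finite set" and E :: "'e::finite set"
  assumes "V \<noteq> {}" "\<forall>f\<in>E. fst (ends f) \<in> V \<and> snd (ends f) \<in> V"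
    and a: "a \<in> lower_points V (edge_cut ends (\<lambda>f. max (y f) 0) E) t"
  shows "point E (\<lambda>w. a w + shift ends E y w) y \<in> conic hull (cosmological_polytope V E ends)"
proof -
  let ?P = "cosmological_polytope V E ends" and ?C = "conic hull (cosmological_polytope V E ends)"
  note gen = cosmological_polytope_generators[where V = V and E = E and ends = ends]
  have "?P \<noteq> {}"
    using gen(1) assms(1) by blast
  then have C: "convex_cone ?C"
    by (intro convex_cone_conic_hull) (simp_all add: cosmological_polytope_def)
  have genC: "ev u \<in> ?C" if "u \<in> V" for u
    using gen(1)[OF that] hull_inc by fast
  have gens: "{ee f, ev (fst (ends f)) + ev (snd (ends f)) - ee f,
      ev (fst (ends f)) - ev (snd (ends f)) + ee f,
      - ev (fst (ends f)) + ev (snd (ends f)) + ee f} \<subseteq> ?C" if "f \<in> E" for f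
    using gen(2)[OF that] hull_subset by (rule order_trans)
  have "point E a (\<lambda>f. max (y f) 0) \<in> ?C"
    by (rule point_mem_cone[OF C genC _ _ _ _ _ a]) (use assms(2) gens in auto)
  moreover have "(\<Sum>f\<in>E. of_int (max (- y f) 0) *\<^sub>R (ev (fst (ends f)) + ev (snd (ends f)) - ee f)) \<in> ?C"
    by (intro convex_cone_sum_mem[OF C] convex_cone_scaleR[OF C]) (use gens in auto)
  moreover have "point E (\<lambda>w. a w + shift ends E y w) y = point E a (\<lambda>f. max (y f) 0) +
      (\<Sum>f\<in>E. of_int (max (- y f) 0) *\<^sub>R (ev (fst (ends f)) + ev (snd (ends f)) - ee f))"
  proof (rule vec_sum_eqI)
    fix w :: 'v
    show "point E (\<lambda>w. a w + shift ends E y w) y $ Inl w = (point E a (\<lambda>f. max (y f) 0) +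
        (\<Sum>f\<in>E. of_int (max (- y f) 0) *\<^sub>R (ev (fst (ends f)) + ev (snd (ends f)) - ee f))) $ Inl w"
      unfolding vector_add_component sum_component point_nth shift_def of_int_add of_int_sum
      by (intro arg_cong2[where f = "(+)"] sum.cong refl) (auto simp: of_bool_def)
  next
    fix g :: 'e
    have "(\<Sum>f\<in>E. of_int (max (- y f) 0) *\<^sub>R
          (ev (fst (ends f)) + ev (snd (ends f)) - ee f :: real ^ ('v + 'e)) $ Inr g) =
        (\<Sum>f\<in>E. if f = g then - of_int (max (- y g) 0) else 0)"
      by (intro sum.cong) auto
    then show "point E (\<lambda>w. a w + shift ends E y w) y $ Inr g = (point E a (\<lambda>f. max (y f) 0) +
        (\<Sum>f\<in>E. of_int (max (- y f) 0) *\<^sub>R (ev (fst (ends f)) + ev (snd (ends f)) - ee f))) $ Inr g"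
      by (cases "g \<in> E") (simp_all add: max_def)
  qed
  ultimately show ?thesis
    using convex_cone_add[OF C] by simp
qed

text \<open>One inclusion comes from the outer cone, the other from the conic hull, where the
  coordinate sum forces the scalar to be j. The box bound N may exceed j, so that one box serves all
  dilates up to N.\<close>

lemma lattice_points_cosmological_polytope:
  fixes V :: "'v::finite set" and E :: "'e::finite set"
  assumes "V \<noteq> {}" and ends: "\<forall>f\<in>E. fst (ends f) \<in> V \<and> snd (ends f) \<in> V" and "j \<le> N"
  shows "{x \<in> (\<lambda>x. real j *\<^sub>R x) ` cosmological_polytope V E ends. \<forall>i. x $ i \<in> \<int>} =
    (\<lambda>(y, a). point E (\<lambda>w. a w + shift ends E y w) y) `
    (SIGMA y : PiE E (\<lambda>_. {- int N .. int N}).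
      lower_points V (edge_cut ends (\<lambda>f. max (y f) 0) E) (int j - (\<Sum>f\<in>E. \<bar>y f\<bar>)))"
    (is "?L = ?p ` ?R")
proof (intro equalityI subsetI)
  fix x assume "x \<in> ?L"
  then obtain p where p: "p \<in> cosmological_polytope V E ends" "x = real j *\<^sub>R p"
    and int: "\<And>i. x $ i \<in> \<int>"
    by blast
  have "x \<in> outer_cone V ends E"
    using cosmological_polytope_subset_outer_cone[OF ends] p
    by (auto intro: convex_cone_scaleR[OF convex_cone_outer_cone])
  then have x: "\<And>w. w \<notin> V \<Longrightarrow> x $ Inl w = 0" "\<And>f. f \<notin> E \<Longrightarrow> x $ Inr f = 0"
      "\<And>S. S \<subseteq> V \<Longrightarrow> 0 \<le> cone_ineq ends E S x"
    by (auto simp: outer_cone_def)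
  \<comment> \<open>Members of \<open>PiE\<close> are undefined outside E, hence
    \<open>restrict\<close>; the floors lose nothing on an integral point.\<close>
  define y where "y = restrict (\<lambda>f. \<lfloor>x $ Inr f\<rfloor>) E"
  define a where "a = (\<lambda>w. \<lfloor>x $ Inl w\<rfloor> - shift ends E y w)"
  have x_eq: "x = point E (\<lambda>w. a w + shift ends E y w) y"
    by (rule vec_sum_eqI) (use int x(2) in \<open>auto simp: a_def y_def\<close>)
  have a0: "a w = 0" if "w \<notin> V" for w
  proof -
    have "shift ends E y w = 0"
      unfolding shift_def by (intro sum.neutral) (use ends that in auto)
    then show ?thesis
      using x(1)[OF that] by (simp add: a_def)
  qed
  have "real_of_int (sum a V + (\<Sum>f\<in>E. \<bar>y f\<bar>)) = (\<Sum>i\<in>UNIV. x $ i)"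
    unfolding x_eq by (rule coordinate_sum_point[symmetric]) (rule a0)
  also have "\<dots> = real_of_int (int j)"
    using coordinate_sum_cosmological_polytope[OF p(1)]
    by (simp add: p(2) flip: sum_distrib_left)
  finally have sum: "sum a V + (\<Sum>f\<in>E. \<bar>y f\<bar>) = int j"
    by (rule of_int_eq_iff[THEN iffD1])
  have "0 \<le> sum a S + edge_cut ends (\<lambda>f. max (y f) 0) E S" if "S \<subseteq> V" for S
    using x(3)[OF that] unfolding x_eq cone_ineq_point by (simp only: of_int_0_le_iff)
  then have a: "a \<in> lower_points V (edge_cut ends (\<lambda>f. max (y f) 0) E) (int j - (\<Sum>f\<in>E. \<bar>y f\<bar>))"
    using a0 sum by (simp add: lower_points_def algebra_simps)
  then have le: "(\<Sum>f\<in>E. \<bar>y f\<bar>) \<le> int j"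
    using lower_points_edge_cut_empty[OF ends, of "int j - (\<Sum>f\<in>E. \<bar>y f\<bar>)"] by fastforce
  have "y f \<in> {- int N .. int N}" if "f \<in> E" for f
  proof -
    have "\<bar>y f\<bar> \<le> (\<Sum>f\<in>E. \<bar>y f\<bar>)"
      using that by (intro member_le_sum) auto
    then show ?thesis
      using le assms(3) by auto
  qed
  then have "y \<in> PiE E (\<lambda>_. {- int N .. int N})"
    by (auto simp: y_def)
  then show "x \<in> ?p ` ?R"
    using a x_eq by (intro image_eqI[of _ _ "(y, a)"]) auto
next
  fix x assume "x \<in> ?p ` ?R"
  then obtain y a where x: "x = point E (\<lambda>w. a w + shift ends E y w) y"
    and a: "a \<in> lower_points V (edge_cut ends (\<lambda>f. max (y f) 0) E) (int j - (\<Sum>f\<in>E. \<bar>y f\<bar>))"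
    by auto
  obtain c p where c: "x = c *\<^sub>R p" "p \<in> cosmological_polytope V E ends"
    using point_shift_mem_conic_hull[OF assms(1,2) a] unfolding x conic_hull_explicit by auto
  have "(\<Sum>i\<in>UNIV. x $ i) = real j"
    unfolding x by (subst coordinate_sum_point[of V]) (use a in \<open>auto simp: lower_points_def\<close>)
  moreover have "(\<Sum>i\<in>UNIV. x $ i) = c"
    using coordinate_sum_cosmological_polytope[OF c(2)]
    by (simp add: c(1) flip: sum_distrib_left)
  moreover have "x $ i \<in> \<int>" for i
    unfolding x by (cases i) (auto simp: point_def)
  ultimately show "x \<in> ?L"
    using c by auto
qed

lemma inj_on_point_shift:
  "inj_on (\<lambda>(y, a). point E (\<lambda>w. a w + shift ends E y w) y) (SIGMA y : PiE E B. A y)"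
proof (rule inj_onI, clarify)
  fix y a y' a'
  assume y: "y \<in> PiE E B" "y' \<in> PiE E B"
    and eq: "point E (\<lambda>w. a w + shift ends E y w) y = point E (\<lambda>w. a' w + shift ends E y' w) y'"
  have "y f = y' f" if "f \<in> E" for f
    using arg_cong[OF eq, of "\<lambda>x. x $ Inr f"] that by simp
  then have "y = y'"
    using y by (intro PiE_ext) auto
  moreover have "a w + shift ends E y w = a' w + shift ends E y' w" for w
    using arg_cong[OF eq, of "\<lambda>x. x $ Inl w"] by (simp del: of_int_add)
  ultimately show "y = y' \<and> a = a'"
    by auto
qed

lemma ehrhart_series_nth:
  fixes V :: "'v::finite set" and E :: "'e::finite set"
  assumes "V \<noteq> {}" and ends: "\<forall>f\<in>E. fst (ends f) \<in> V \<and> snd (ends f) \<in> V" and "j \<le> N"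
  shows "fps_nth (ehrhart_series (cosmological_polytope V E ends)) j =
    fps_nth (\<Sum>y\<in>PiE E (\<lambda>_. {- int N .. int N}).
      (\<Prod>f\<in>E. fps_X ^ nat \<bar>y f\<bar>) * cut_series V ends (\<lambda>f. max (y f) 0) E) j"
proof -
  let ?B = "PiE E (\<lambda>_. {- int N .. int N})"
  let ?L = "\<lambda>y. lower_points V (edge_cut ends (\<lambda>f. max (y f) 0) E)"
  have "lattice_count (cosmological_polytope V E ends) j =
      card (SIGMA y : ?B. ?L y (int j - (\<Sum>f\<in>E. \<bar>y f\<bar>)))"
    unfolding lattice_count_def lattice_points_cosmological_polytope[OF assms]
    by (rule card_image[OF inj_on_point_shift])
  also have "\<dots> = (\<Sum>y\<in>?B. card (?L y (int j - (\<Sum>f\<in>E. \<bar>y f\<bar>))))"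
    by (intro card_SigmaI ballI finite_PiE) (simp_all add: finite_lower_points)
  finally have "fps_nth (ehrhart_series (cosmological_polytope V E ends)) j =
      (\<Sum>y\<in>?B. int (card (?L y (int j - (\<Sum>f\<in>E. \<bar>y f\<bar>)))))"
    by (simp add: ehrhart_series_def)
  also have "\<dots> = (\<Sum>y\<in>?B. fps_nth ((\<Prod>f\<in>E. fps_X ^ nat \<bar>y f\<bar>) * cut_series V ends (\<lambda>f. max (y f) 0) E) j)"
  proof (intro sum.cong refl)
    fix y :: "'e \<Rightarrow> int"
    let ?k = "\<Sum>f\<in>E. nat \<bar>y f\<bar>"
    have k: "(\<Sum>f\<in>E. \<bar>y f\<bar>) = int ?k"
      by simp
    show "int (card (?L y (int j - (\<Sum>f\<in>E. \<bar>y f\<bar>)))) =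
        fps_nth ((\<Prod>f\<in>E. fps_X ^ nat \<bar>y f\<bar>) * cut_series V ends (\<lambda>f. max (y f) 0) E) j"
      unfolding k power_sum[symmetric] fps_X_power_mult_nth
      \<comment> \<open>For j < k the shifted series has coefficient 0, and on the other side the
        level j - k is negative.\<close>
      using lower_points_edge_cut_empty[OF ends]
      by (cases "j < ?k") (simp_all add: cut_series_def of_nat_diff del: of_nat_sum)
  qed
  finally show ?thesis
    by (simp add: fps_sum_nth)
qed

section \<open>Summation over the value of one edge\<close>

lemma sum_symmetric_interval_Suc:
  "(\<Sum>k = - int (Suc N)..int (Suc N). g k) =
    g (int (Suc N)) + (g (- int (Suc N)) + (\<Sum>k = - int N..int N. g k :: 'a::comm_monoid_add))"
proof -
  have "{- int (Suc N)..int (Suc N)} = insert (int (Suc N)) (insert (- int (Suc N)) {- int N..int N})"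
    by auto
  then show ?thesis
    by simp
qed

text \<open>The share of one edge with value k, where b tells whether the edge belongs to the
  forest. Over all integers k these add up to 1 + z if b is false, and to 2 (1 - z)^2 times the sum
  of k z^k over k >= 0, that is 2z, if b is true.\<close>

definition edge_weight :: "bool \<Rightarrow> int \<Rightarrow> int fps" where
  "edge_weight b k = (1 - fps_X) * fps_X ^ nat \<bar>k\<bar> *
     (if b then fps_const (2 * max k 0) * (1 - fps_X) else 1)"

lemma sum_edge_weight_False:
  "(\<Sum>k = - int N..int N. edge_weight False k) = 1 + fps_X - 2 * fps_X ^ Suc N"
proof (induction N)
  case 0
  then show ?case
    by (simp add: edge_weight_def)
next
  case (Suc N)
  then show ?case
    unfolding sum_symmetric_interval_Suc by (simp add: edge_weight_def algebra_simps nat_add_distrib)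
qed

lemma sum_edge_weight_True:
  "(\<Sum>k = - int N..int N. edge_weight True k) =
    2 * fps_X - 2 * of_nat (Suc N) * fps_X ^ Suc N + 2 * of_nat N * fps_X ^ Suc (Suc N)"
proof (induction N)
  case 0
  then show ?case
    by (simp add: edge_weight_def)
next
  case (Suc N)
  have c: "fps_const c = of_int c" for c :: int
    using fps_of_int[of c, where 'a = int] by simp
  have 1: "edge_weight True (- int (Suc N)) = 0"
    by (simp add: edge_weight_def)
  have 2: "edge_weight True (int (Suc N)) = (1 - fps_X) * fps_X ^ Suc N * (2 * of_nat (Suc N) * (1 - fps_X))"
    unfolding edge_weight_def c by (simp add: nat_add_distrib)
  show ?case
    unfolding sum_symmetric_interval_Suc 1 2 Suc by (simp add: algebra_simps)
qed

text \<open>The closed forms show that truncating at N leaves an error divisible by z^(N+1),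
  invisible in the coefficient of z^N.\<close>

lemma sum_edge_weight_cong:
  "fps_X ^ Suc N dvd (\<Sum>k = - int N..int N. edge_weight b k) - (if b then 2 * fps_X else 1 + fps_X)"
proof (cases b)
  case True
  then have b: "b = True"
    by simp
  have "(\<Sum>k = - int N..int N. edge_weight b k) - 2 * fps_X =
      fps_X ^ Suc N * (2 * of_nat N * fps_X - 2 * of_nat (Suc N))"
    unfolding b sum_edge_weight_True by (simp add: algebra_simps)
  then show ?thesis
    using True by simp
next
  case False
  then have b: "b = False"
    by simp
  have "(\<Sum>k = - int N..int N. edge_weight b k) - (1 + fps_X) = fps_X ^ Suc N * (- 2)"
    unfolding b sum_edge_weight_False by (simp add: algebra_simps)
  then show ?thesis
    using False by (simp del: mult_minus_right)
qed

text \<open>Congruence modulo d passes to products by exchanging one factor at a time.\<close>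

lemma dvd_prod_diff:
  fixes a b :: "'i \<Rightarrow> 'a::comm_ring_1"
  assumes "\<And>i. i \<in> I \<Longrightarrow> d dvd a i - b i"
  shows "d dvd prod a I - prod b I"
  using assms
proof (induction I rule: infinite_finite_induct)
  case (insert i I)
  have "prod a (insert i I) - prod b (insert i I) = a i * (prod a I - prod b I) + (a i - b i) * prod b I"
    using insert.hyps by (simp add: algebra_simps)
  then show ?case
    using insert by simp
qed simp_all

theorem mainTheorem11:
  fixes V :: "'v::finite set" and E :: "'e::finite set" and ends :: "'e \<Rightarrow> 'v \<times> 'v"
  assumes "V \<noteq> {}"
    and "\<forall>f\<in>E. fst (ends f) \<in> V \<and> snd (ends f) \<in> V"
  shows "h_star_series (cosmological_polytope V E ends) =
    (\<Sum>H\<in>{H. H \<subseteq> E \<and> \<not> has_cycle ends H}.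
       (fps_const 2 * fps_X) ^ card H * (1 + fps_X) ^ (card E - card H))"
proof (rule fps_ext)
  fix N
  let ?P = "cosmological_polytope V E ends" and ?F = "{H. H \<subseteq> E \<and> \<not> has_cycle ends H}"
  let ?D = "1 - fps_X :: int fps" and ?B = "PiE E (\<lambda>_. {- int N .. int N})"
  define S :: "int fps" where "S = (\<Sum>y\<in>?B.
      (\<Prod>f\<in>E. fps_X ^ nat \<bar>y f\<bar>) * cut_series V ends (\<lambda>f. max (y f) 0) E)"
  have dim: "nat (aff_dim ?P + 1) = card V + card E"
    using aff_dim_cosmological_polytope[OF assms(2)] by simp
  \<comment> \<open>Multiplying by a power of 1 - z mixes only coefficients of index at most N, and
    on these \<open>S\<close> agrees with the Ehrhart series.\<close>
  have "fps_nth (h_star_series ?P) N = fps_nth (S * ?D ^ (card V + card E)) N"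
    unfolding h_star_series_def dim fps_mult_nth S_def
    by (intro sum.cong refl arg_cong2[where f = "(*)"] ehrhart_series_nth[OF assms]) simp
  also have "S * ?D ^ (card V + card E) = (\<Sum>H\<in>?F. \<Prod>f\<in>E. \<Sum>k = - int N..int N. edge_weight (f \<in> H) k)"
  proof -
    \<comment> \<open>The power with exponent \<open>card V\<close> clears the denominator of the
      cut series; the other factors 1 - z are dealt out one to each edge, as in
      \<open>edge_weight\<close>.\<close>
    have "S * ?D ^ (card V + card E) = (\<Sum>y\<in>?B. (?D ^ card E * (\<Prod>f\<in>E. fps_X ^ nat \<bar>y f\<bar>)) *
        (?D ^ card V * cut_series V ends (\<lambda>f. max (y f) 0) E))"
      unfolding S_def sum_distrib_right by (simp add: power_add ac_simps)
    also have "\<dots> = (\<Sum>y\<in>?B. \<Sum>H\<in>?F. \<Prod>f\<in>E. edge_weight (f \<in> H) (y f))"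
    proof (intro sum.cong refl)
      fix y :: "'e \<Rightarrow> int"
      let ?w = "\<lambda>f. fps_const (2 * max (y f) 0) * ?D"
      have "?D ^ card V * cut_series V ends (\<lambda>f. max (y f) 0) E = (\<Sum>H\<in>?F. \<Prod>f\<in>H. ?w f)"
        using assms(2) by (intro cut_series_eq) auto
      also have "?D ^ card E * (\<Prod>f\<in>E. fps_X ^ nat \<bar>y f\<bar>) * \<dots> =
          (\<Sum>H\<in>?F. \<Prod>f\<in>E. edge_weight (f \<in> H) (y f))"
        unfolding sum_distrib_left
      proof (intro sum.cong refl)
        fix H assume "H \<in> ?F"
        then have "(\<Prod>f\<in>H. ?w f) = (\<Prod>f\<in>E. if f \<in> H then ?w f else 1)"
          by (intro prod.mono_neutral_cong_left) auto
        then show "?D ^ card E * (\<Prod>f\<in>E. fps_X ^ nat \<bar>y f\<bar>) * (\<Prod>f\<in>H. ?w f) =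
            (\<Prod>f\<in>E. edge_weight (f \<in> H) (y f))"
          by (simp only: edge_weight_def prod.distrib prod_constant)
      qed
      finally show "?D ^ card E * (\<Prod>f\<in>E. fps_X ^ nat \<bar>y f\<bar>) *
          (?D ^ card V * cut_series V ends (\<lambda>f. max (y f) 0) E) =
          (\<Sum>H\<in>?F. \<Prod>f\<in>E. edge_weight (f \<in> H) (y f))" .
    qed
    \<comment> \<open>The forests range independently of y, so for a fixed forest the sum over the
      box factors into one sum per edge.\<close>
    also have "\<dots> = (\<Sum>H\<in>?F. \<Sum>y\<in>?B. \<Prod>f\<in>E. edge_weight (f \<in> H) (y f))"
      by (rule sum.swap)
    also have "\<dots> = (\<Sum>H\<in>?F. \<Prod>f\<in>E. \<Sum>k = - int N..int N. edge_weight (f \<in> H) k)"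
      by (intro sum.cong refl prod_sum_PiE[symmetric]) simp_all
    finally show ?thesis .
  qed
  also have "fps_nth \<dots> N = fps_nth (\<Sum>H\<in>?F. \<Prod>f\<in>E. if f \<in> H then 2 * fps_X else 1 + fps_X) N"
    (is "fps_nth ?A N = fps_nth ?C N")
  proof -
    have "fps_X ^ Suc N dvd ?A - ?C"
      unfolding sum_subtractf[symmetric]
      by (intro dvd_sum dvd_prod_diff sum_edge_weight_cong)
    then obtain R where "?A - ?C = fps_X ^ Suc N * R"
      by (rule dvdE)
    then have "fps_nth (?A - ?C) N = 0"
      by (simp only: fps_X_power_mult_nth) simp
    then show ?thesis
      by simp
  qed
  also have "(\<Sum>H\<in>?F. \<Prod>f\<in>E. if f \<in> H then 2 * fps_X else 1 + fps_X) =
      (\<Sum>H\<in>?F. (fps_const 2 * fps_X) ^ card H * (1 + fps_X) ^ (card E - card H) :: int fps)"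
  proof (intro sum.cong refl)
    fix H assume "H \<in> ?F"
    then have H: "H \<subseteq> E"
      by simp
    then have "E \<inter> {f. f \<in> H} = H" "E \<inter> - {f. f \<in> H} = E - H"
      by auto
    then show "(\<Prod>f\<in>E. if f \<in> H then 2 * fps_X else 1 + fps_X) =
        (fps_const 2 * fps_X) ^ card H * (1 + fps_X :: int fps) ^ (card E - card H)"
      using H by (simp add: prod.If_cases card_Diff_subset numeral_fps_const)
  qed
  finally show "fps_nth (h_star_series ?P) N = fps_nth (\<Sum>H\<in>?F.
      (fps_const 2 * fps_X) ^ card H * (1 + fps_X) ^ (card E - card H)) N" .
qed

end
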